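(* Consider the two-stage distributed algorithms (described in the context) for the LASSO-like problem (resp. the BPDN-like problem) with the norm $\|\cdot\|_\star$. Let $(y^k)$ be a sequence generated in the first stage such that $y^k\to y_*$ as $k\to\infty$ and $b+y^k\in A\mathcal C$ (resp. $b+\frac{\sigma y^k}{\|y^k\|_2}\in A\mathcal C$) for all large $k$, where $y_*$ is (the $y$-component of) a solution to the dual problem $(D_L)$ (resp. $(D_B)$), and let $(x^s)$ be a convergent sequence in the second stage for solving the regularized BP-like problem $(R_L)$ (resp. $(R_B)$). Then the following hold: (i) $(x^s)\to x_*$ as $k,s\to\infty$, where $x_*$ is the unique solution to the regularized BP-like problem $(R_L)$ (resp. $(R_B)$). (ii) Let $\|\cdot\|_\star$ be the $\ell_1$-norm. Suppose $(y^k)$ has the convergence rate $O(\frac{1}{k^q})$ and $(x^s)$ has the convergence rate $O(\frac{1}{s^r})$. Then $(x^s)$ converges to $x_*$ in the rate of $O(\frac{1}{k^q})+O(\frac{1}{s^r})$.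
   Context: Let $A\in\mathbb R^{m\times N}$, $b\in\mathbb R^m$, $E\in\mathbb R^{n\times N}$, let $\|\cdot\|_\star$ be a norm on $\mathbb R^{n}$ with dual norm $\|z\|_\diamond:=\sup\{z^Tv \mid \|v\|_\star\le 1\}$, and let $\mathcal C:=\{x\in\mathbb R^N \mid Cx\le d\}$ be a nonempty polyhedral set with $C\in\mathbb R^{\ell\times N}$, $d\in\mathbb R^\ell$. Write $A\mathcal C:=\{Ax \mid x\in\mathcal C\}$. LASSO-like problem: $\min_{x\in\mathcal C}\ \frac12\|Ax-b\|_2^2+\|Ex\|_\star$. Its dual problem is $(D_L)$: $\min_{y\in\mathbb R^m,\ \mu\in\mathbb R^\ell_+,\ \|v\|_\diamond\le1}\{\frac12\|y\|_2^2+b^Ty+d^T\mu \,:\, A^Ty+E^Tv+C^T\mu=0\}$. BPDN-like problem: $\min_{x\in\mathcal C,\ \|Ax-b\|_2\le\sigma}\|Ex\|_\star$ with $\sigma>0$. Its dual problem is $(D_B)$: $\min_{y\in\mathbb R^m,\ \mu\in\mathbb R^\ell_+,\ \|v\|_\diamond\le1}\{b^Ty+\sigma\|y\|_2+d^T\mu \,:\, A^Ty+E^Tv+C^T\mu=0\}$. Standing assumptions for the BPDN-like problem: it is feasible with positive optimal value, $\|b\|_2>\sigma$, $0\in\mathcal C$, and there is $\tilde x$ in the relative interior of $\mathcal C$ with $\|A\tilde x-b\|_2<\sigma$ (under these assumptions $y_*\neq 0$ for every dual solution). Regularized BP-like problems, for a fixed (sufficiently small) $\alpha>0$: $(R_L)$: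 $\min_{x\in\mathbb R^N}\ \|Ex\|_\star+\frac{\alpha}{2}\|x\|_2^2$ subject to $Ax=b+y_*$, $x\in\mathcal C$; $(R_B)$: $\min_{x\in\mathbb R^N}\ \|Ex\|_\star+\frac{\alpha}{2}\|x\|_2^2$ subject to $Ax=b+\frac{\sigma y_*}{\|y_*\|_2}$, $x\in\mathcal C$. Two-stage algorithm: the first stage computes a dual solution $y_*$ of the LASSO-like (resp. BPDN-like) problem by a distributed scheme, which generates a sequence $(y^k)$ approximating $y_*$. The second stage solves $(R_L)$ (resp. $(R_B)$) by a convergent distributed scheme generating iterates $(x^s)$; in practice $y_*$ in the equality constraint is replaced by $y^k$ with $k$ large, i.e., the constraint is $Ax=b+y^k$ (resp. $Ax=b+\frac{\sigma y^k}{\|y^k\|_2}$), and the iterates $x^s$ thus depend on $k$ as well and, for fixed $k$, converge as $s\to\infty$ to the unique solution of the problem with that constraint. *)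

theory Defs
  imports "HOL-Analysis.Analysis" "HOL-Library.Landau_Symbols"
begin

definition is_norm :: "(real^'p \<Rightarrow> real) \<Rightarrow> bool" where
  "is_norm nrm \<longleftrightarrow>
     (\<forall>v. 0 \<le> nrm v) \<and>
     (\<forall>v. nrm v = 0 \<longleftrightarrow> v = 0) \<and>
     (\<forall>c v. nrm (c *\<^sub>R v) = \<bar>c\<bar> * nrm v) \<and>
     (\<forall>u v. nrm (u + v) \<le> nrm u + nrm v)"

definition dual_norm :: "(real^'p \<Rightarrow> real) \<Rightarrow> real^'p \<Rightarrow> real" where
  "dual_norm nrm z = Sup {z \<bullet> v | v. nrm v \<le> 1}"

definition l1_norm :: "real^'p \<Rightarrow> real" where
  "l1_norm v = (\<Sum>i\<in>UNIV. \<bar>v $ i\<bar>)"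

text \<open>The order on vectors is the library's componentwise order.\<close>

definition poly_set :: "real^'n^'l \<Rightarrow> real^'l \<Rightarrow> (real^'n) set" where
  "poly_set C d = {x. C *v x \<le> d}"

definition dual_feasible ::
  "real^'n^'m \<Rightarrow> real^'n^'p \<Rightarrow> real^'n^'l \<Rightarrow> (real^'p \<Rightarrow> real)
     \<Rightarrow> (real^'m) \<times> (real^'l) \<times> (real^'p) \<Rightarrow> bool" where
  "dual_feasible A E C nrm = (\<lambda>(y, \<mu>, v).
     0 \<le> \<mu> \<and> dual_norm nrm v \<le> 1 \<and>
     transpose A *v y + transpose E *v v + transpose C *v \<mu> = 0)"

text \<open>A dual solution means its \<open>y\<close>-component; \<open>\<mu>\<close> and \<open>v\<close> are existentially quantified.\<close>

definition lasso_dual_solution ::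
  "real^'n^'m \<Rightarrow> real^'m \<Rightarrow> real^'n^'p \<Rightarrow> real^'n^'l \<Rightarrow> real^'l \<Rightarrow> (real^'p \<Rightarrow> real)
     \<Rightarrow> real^'m \<Rightarrow> bool" where
  "lasso_dual_solution A b E C d nrm y \<longleftrightarrow>
     (\<exists>\<mu> v. is_arg_min (\<lambda>(y, \<mu>, v). 1/2 * (norm y)\<^sup>2 + b \<bullet> y + d \<bullet> \<mu>)
              (dual_feasible A E C nrm) (y, \<mu>, v))"

definition bpdn_dual_solution ::
  "real^'n^'m \<Rightarrow> real^'m \<Rightarrow> real^'n^'p \<Rightarrow> real^'n^'l \<Rightarrow> real^'l \<Rightarrow> (real^'p \<Rightarrow> real)
     \<Rightarrow> real \<Rightarrow> real^'m \<Rightarrow> bool" where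
  "bpdn_dual_solution A b E C d nrm \<sigma> y \<longleftrightarrow>
     (\<exists>\<mu> v. is_arg_min (\<lambda>(y, \<mu>, v). b \<bullet> y + \<sigma> * norm y + d \<bullet> \<mu>)
              (dual_feasible A E C nrm) (y, \<mu>, v))"

definition bpdn_feasible_set ::
  "real^'n^'m \<Rightarrow> real^'m \<Rightarrow> real^'n^'l \<Rightarrow> real^'l \<Rightarrow> real \<Rightarrow> (real^'n) set" where
  "bpdn_feasible_set A b C d \<sigma> = {x \<in> poly_set C d. norm (A *v x - b) \<le> \<sigma>}"

definition bpdn_standing ::
  "real^'n^'m \<Rightarrow> real^'m \<Rightarrow> real^'n^'p \<Rightarrow> real^'n^'l \<Rightarrow> real^'l \<Rightarrow> (real^'p \<Rightarrow> real)
     \<Rightarrow> real \<Rightarrow> bool" where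
  "bpdn_standing A b E C d nrm \<sigma> \<longleftrightarrow>
     0 < \<sigma> \<and>
     bpdn_feasible_set A b C d \<sigma> \<noteq> {} \<and>
     0 < (INF x\<in>bpdn_feasible_set A b C d \<sigma>. nrm (E *v x)) \<and>
     \<sigma> < norm b \<and>
     0 \<in> poly_set C d \<and>
     (\<exists>x \<in> rel_interior (poly_set C d). norm (A *v x - b) < \<sigma>)"

definition lasso_rhs :: "real^'m \<Rightarrow> real^'m \<Rightarrow> real^'m" where
  "lasso_rhs b y = b + y"

definition bpdn_rhs :: "real^'m \<Rightarrow> real \<Rightarrow> real^'m \<Rightarrow> real^'m" where
  "bpdn_rhs b \<sigma> y = b + (\<sigma> / norm y) *\<^sub>R y"

definition reg_bp_solution ::
  "real^'n^'m \<Rightarrow> real^'n^'p \<Rightarrow> real^'n^'l \<Rightarrow> real^'l \<Rightarrow> (real^'p \<Rightarrow> real) \<Rightarrow> real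
     \<Rightarrow> real^'m \<Rightarrow> real^'n \<Rightarrow> bool" where
  "reg_bp_solution A E C d nrm \<alpha> w x \<longleftrightarrow>
     is_arg_min (\<lambda>x. nrm (E *v x) + \<alpha> / 2 * (norm x)\<^sup>2)
       (\<lambda>x. A *v x = w \<and> x \<in> poly_set C d) x"

text \<open>Meaningful only where the minimizer exists and is unique.\<close>

definition the_reg_bp_solution ::
  "real^'n^'m \<Rightarrow> real^'n^'p \<Rightarrow> real^'n^'l \<Rightarrow> real^'l \<Rightarrow> (real^'p \<Rightarrow> real) \<Rightarrow> real
     \<Rightarrow> real^'m \<Rightarrow> real^'n" where
  "the_reg_bp_solution A E C d nrm \<alpha> w = (THE x. reg_bp_solution A E C d nrm \<alpha> w x)"

end

(* The admissible right-hand sides form a closed set, being the linear image of a polyhedron, so the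
   limit problem is feasible, and strong convexity makes every solution unique. Locally a polyhedron
   is a cone, and a linear image of a polyhedral cone admits a norm-bounded lift; hence the feasible
   set varies lower semicontinuously and the solution depends continuously on the right-hand side.
   For the l1-norm, fixing the signs of E x and the active constraints of x turns optimality into
   linear inequalities in x. The solutions for all right-hand sides thus form finitely many convex
   sets, on each of which A is injective and therefore has a Lipschitz inverse; this makes the
   error of the second stage at most proportional to that of the first. In the BPDN case the map
   from y to the right-hand side is Lipschitz at ystar because ystar is nonzero: with y = 0 the
   dual value is nonnegative, whereas separation and Farkas' lemma give a negative one. *)

theory Submission
  imports Defs
begin

section \<open>Polyhedral cones and linear images of polyhedra\<close>

lemma polyhedron_inequalities:
  fixes a :: "'i::finite \<Rightarrow> 'a::euclidean_space"
  shows "polyhedron {x. \<forall>i. a i \<bullet> x \<le> \<beta> i}"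
proof -
  have "{x. \<forall>i. a i \<bullet> x \<le> \<beta> i} = \<Inter> (range (\<lambda>i. {x. a i \<bullet> x \<le> \<beta> i}))"
    by auto
  moreover have "polyhedron (\<Inter> (range (\<lambda>i. {x. a i \<bullet> x \<le> \<beta> i})))"
    by (rule polyhedron_Inter) (auto simp: polyhedron_halfspace_le)
  ultimately show ?thesis by simp
qed

lemma convex_cone_inequalities:
  fixes a :: "'i \<Rightarrow> 'a::real_inner"
  shows "convex_cone {x. \<forall>i. a i \<bullet> x \<le> 0}"
proof -
  have "{x. \<forall>i. a i \<bullet> x \<le> 0} = \<Inter> (range (\<lambda>i. {x. a i \<bullet> x \<le> 0}))"
    by auto
  moreover have "convex_cone (\<Inter> (range (\<lambda>i. {x. a i \<bullet> x \<le> 0})))"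
    by (intro convex_cone_Inter) (auto simp: convex_cone_halfspace_le)
  ultimately show ?thesis by simp
qed

lemma convex_cone_Int: "\<lbrakk>convex_cone S; convex_cone T\<rbrakk> \<Longrightarrow> convex_cone (S \<inter> T)"
  using convex_cone_Inter [of "{S, T}"] by auto

lemma cball_subset_cbox_One: "cball 0 1 \<subseteq> cbox (- One) (One :: 'a::euclidean_space)"
  by (auto simp: mem_box abs_le_iff dest!: order_trans [OF Basis_le_norm])

text \<open>Every nonzero point of the cone is a positive multiple of a unit vector in
  \<open>P\<close>, so a bounded piece around the apex already generates \<open>T\<close>.\<close>

lemma convex_cone_hull_unit_ball:
  fixes T P :: "'a::real_normed_vector set"
  assumes T: "convex_cone T" and P: "T \<inter> cball 0 1 \<subseteq> P" "P \<subseteq> T"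
  shows "convex_cone hull P = T"
proof (rule antisym)
  show "convex_cone hull P \<subseteq> T"
    using P T by (intro hull_minimal) auto
  show "T \<subseteq> convex_cone hull P"
  proof
    fix x assume x: "x \<in> T"
    show "x \<in> convex_cone hull P"
    proof (cases "x = 0")
      case False
      have "x /\<^sub>R norm x \<in> P"
        using x False P(1) convex_cone_scaleR [OF T _ x, of "inverse (norm x)"] by auto
      then have "norm x *\<^sub>R (x /\<^sub>R norm x) \<in> convex_cone hull P"
        by (intro convex_cone_hull_mul hull_inc) auto
      then show ?thesis using False by simp
    qed (simp add: convex_cone_hull_contains_0)
  qed
qed

text \<open>A box in place of the unit ball makes the truncated cone a polytope, hence the hull of
  finitely many points.\<close>

lemma polyhedral_cone_generators:
  fixes T :: "'a::euclidean_space set"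
  assumes "polyhedron T" "convex_cone T"
  obtains V where "finite V" "T \<inter> cball 0 1 \<subseteq> convex hull V" "convex hull V \<subseteq> T"
proof -
  have "polytope (T \<inter> cbox (- One) One)"
    using assms by (simp add: polytope_interval polyhedron_Int_polytope)
  then obtain V where "finite V" "T \<inter> cbox (- One) One = convex hull V"
    unfolding polytope_def by blast
  then show ?thesis
    using that[of V] cball_subset_cbox_One by (metis Int_lower1 Int_mono order_refl)
qed

text \<open>Finite generation passes to the image, and a finitely generated cone is again
  polyhedral.\<close>

lemma polyhedron_cone_linear_image:
  fixes f :: "'a::euclidean_space \<Rightarrow> 'b::euclidean_space"
  assumes T: "polyhedron T" "convex_cone T" and f: "linear f"
  shows "polyhedron (f ` T)"
proof -
  obtain V where V: "finite V" "T \<inter> cball 0 1 \<subseteq> convex hull V" "convex hull V \<subseteq> T"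
    using polyhedral_cone_generators [OF T] .
  have "T = convex_cone hull (convex hull V)"
    using convex_cone_hull_unit_ball [OF T(2) V(2,3)] by simp
  also have "\<dots> = convex_cone hull V"
    by (simp add: convex_cone_hull_convex_hull)
  finally have "f ` T = convex_cone hull (f ` V)"
    by (simp add: convex_cone_hull_linear_image f)
  then show ?thesis
    using polyhedron_convex_cone_hull [of "f ` V"] V(1) by simp
qed

text \<open>Only finitely many generators of the image cone have to be lifted; convexity and scaling
  extend their lifts to every point, with a bound proportional to the norm.\<close>

lemma polyhedral_cone_bounded_lift:
  fixes f :: "'a::euclidean_space \<Rightarrow> 'b::euclidean_space"
  assumes T: "polyhedron T" "convex_cone T" and f: "linear f"
  obtains L where "0 \<le> L" "\<And>g. g \<in> f ` T \<Longrightarrow> \<exists>h\<in>T. f h = g \<and> norm h \<le> L * norm g"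
proof -
  have cone: "convex_cone (f ` T)"
    using T(2) f by (simp add: convex_cone_linear_image)
  obtain V where V: "finite V" "f ` T \<inter> cball 0 1 \<subseteq> convex hull V" "convex hull V \<subseteq> f ` T"
    using polyhedral_cone_generators [OF polyhedron_cone_linear_image [OF T f] cone] .
  have "V \<subseteq> f ` T"
    using V(3) hull_subset by (rule order_trans [rotated])
  \<comment> \<open>\<open>W\<close> holds a preimage in \<open>T\<close> for each generator; the
    norm bound on its convex hull becomes \<open>L\<close>.\<close>
  then obtain W where W: "W \<subseteq> T" "finite W" "V = f ` W"
    using V(1) finite_subset_image by metis
  have hull: "convex hull W \<subseteq> T"
    using W(1) T by (intro hull_minimal) (auto simp: polyhedron_imp_convex)
  have "bounded (convex hull W)"
    using W(2) by (simp add: bounded_convex_hull finite_imp_bounded)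
  then obtain L where L: "0 < L" "\<And>h. h \<in> convex hull W \<Longrightarrow> norm h \<le> L"
    using bounded_pos by metis
  show ?thesis
  proof (rule that)
    show "0 \<le> L" using L by simp
    fix g assume g: "g \<in> f ` T"
    show "\<exists>h\<in>T. f h = g \<and> norm h \<le> L * norm g"
    proof (cases "g = 0")
      case True
      then show ?thesis
        using convex_cone_contains_0 [OF T(2)] linear_0 [OF f] by auto
    next
      case False
      have "g /\<^sub>R norm g \<in> f ` T" "g /\<^sub>R norm g \<in> cball 0 1"
        using convex_cone_scaleR [OF cone _ g, of "inverse (norm g)"] False by simp_all
      then have "g /\<^sub>R norm g \<in> convex hull (f ` W)"
        using V(2) W(3) by blast
      then obtain h where h: "h \<in> convex hull W" "f h = g /\<^sub>R norm g"
        by (metis convex_hull_linear_image [OF f] imageE)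
      show ?thesis
      proof (intro bexI conjI)
        show "f (norm g *\<^sub>R h) = g"
          using h False by (simp add: linear_cmul [OF f])
        show "norm (norm g *\<^sub>R h) \<le> L * norm g"
          using L(2) [OF h(1)] by (simp add: mult.commute mult_right_mono)
        show "norm g *\<^sub>R h \<in> T"
          using hull h(1) by (intro convex_cone_scaleR [OF T(2)]) auto
      qed
    qed
  qed
qed

section \<open>Polyhedra given by inequalities: closed images, local lifts and Farkas' lemma\<close>

lemma mem_poly_set: "x \<in> poly_set C d \<longleftrightarrow> (\<forall>i. C $ i \<bullet> x \<le> d $ i)"
  by (simp add: poly_set_def less_eq_vec_def matrix_vector_mul_component)

lemma polyhedron_poly_set: "polyhedron (poly_set C d)"
proof -
  have "poly_set C d = {x. \<forall>i. C $ i \<bullet> x \<le> d $ i}"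
    by (auto simp: mem_poly_set)
  then show ?thesis by (simp add: polyhedron_inequalities)
qed

lemma convex_poly_set: "convex (poly_set C d)"
  by (simp add: polyhedron_poly_set polyhedron_imp_convex)

text \<open>Homogenising reduces the image of a polyhedron to the slice at height 1 of the image of a
  polyhedral cone.\<close>

lemma closed_linear_image_poly_set:
  fixes C :: "real^'n^'l" and f :: "real^'n \<Rightarrow> 'b::euclidean_space"
  assumes f: "linear f"
  shows "closed (f ` poly_set C d)"
proof -
  \<comment> \<open>A point \<open>(x, t)\<close> of \<open>T\<close> satisfies C x \<le> t d with t
    \<ge> 0, so height 1 gives back the polyhedron.\<close>
  define T :: "((real^'n) \<times> real) set"
    where "T = {p. \<forall>i. (C $ i, - d $ i) \<bullet> p \<le> 0} \<inter> {p. (0, -1) \<bullet> p \<le> 0}"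
  have "polyhedron T"
    unfolding T_def by (intro polyhedron_Int polyhedron_inequalities polyhedron_halfspace_le)
  moreover have "convex_cone T"
    unfolding T_def by (intro convex_cone_Int convex_cone_inequalities convex_cone_halfspace_le)
  moreover have "linear (\<lambda>p::(real^'n) \<times> real. (f (fst p), snd p))"
    using f by (auto simp: linear_iff)
  ultimately have "closed ((\<lambda>p. (f (fst p), snd p)) ` T)"
    by (intro polyhedron_imp_closed polyhedron_cone_linear_image)
  then have "closed ((\<lambda>g. (g, 1::real)) -` ((\<lambda>p. (f (fst p), snd p)) ` T))"
    by (intro closed_vimage continuous_intros) auto
  moreover have "(\<lambda>g. (g, 1::real)) -` ((\<lambda>p. (f (fst p), snd p)) ` T) = f ` poly_set C d"
  proof (intro set_eqI iffI)
    fix g assume "g \<in> (\<lambda>g. (g, 1::real)) -` ((\<lambda>p. (f (fst p), snd p)) ` T)"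
    then obtain x where "(x, 1) \<in> T" "g = f x" by auto
    then show "g \<in> f ` poly_set C d" by (auto simp: T_def mem_poly_set)
  next
    fix g assume "g \<in> f ` poly_set C d"
    then obtain x where "x \<in> poly_set C d" "g = f x" by auto
    then have "(x, 1) \<in> T" "(g, 1) = (f (fst (x, 1::real)), snd (x, 1::real))"
      by (auto simp: T_def mem_poly_set)
    then show "g \<in> (\<lambda>g. (g, 1::real)) -` ((\<lambda>p. (f (fst p), snd p)) ` T)" by blast
  qed
  ultimately show ?thesis by simp
qed

text \<open>Near \<open>x\<^sub>0\<close> the polyhedron coincides with \<open>x\<^sub>0\<close> plus the cone cut out by the active
  constraints, so the bounded lift of the cone applies.\<close>

lemma poly_set_local_lift:
  fixes C :: "real^'n^'l" and f :: "real^'n \<Rightarrow> 'b::euclidean_space"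
  assumes f: "linear f" and x0: "x0 \<in> poly_set C d"
  obtains L \<delta> where "0 \<le> L" "0 < \<delta>"
    "\<And>w. \<lbrakk>w \<in> f ` poly_set C d; norm (w - f x0) < \<delta>\<rbrakk>
        \<Longrightarrow> \<exists>u \<in> poly_set C d. f u = w \<and> norm (u - x0) \<le> L * norm (w - f x0)"
proof -
  define a where "a i = (if C $ i \<bullet> x0 = d $ i then C $ i else 0)" for i
  define T where "T = {h. \<forall>i. a i \<bullet> h \<le> 0}"
  have cone: "convex_cone T"
    unfolding T_def by (rule convex_cone_inequalities)
  have "polyhedron T"
    unfolding T_def by (rule polyhedron_inequalities)
  then obtain L where L: "0 \<le> L" "\<And>g. g \<in> f ` T \<Longrightarrow> \<exists>h\<in>T. f h = g \<and> norm h \<le> L * norm g"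
    using polyhedral_cone_bounded_lift [OF _ cone f] by metis
  have "\<forall>\<^sub>F h in nhds 0. \<forall>i. C $ i \<bullet> x0 \<noteq> d $ i \<longrightarrow> C $ i \<bullet> (x0 + h) < d $ i"
  proof (rule eventually_all_finite)
    fix i
    show "\<forall>\<^sub>F h in nhds 0. C $ i \<bullet> x0 \<noteq> d $ i \<longrightarrow> C $ i \<bullet> (x0 + h) < d $ i"
    proof (cases "C $ i \<bullet> x0 = d $ i")
      case False
      then have "C $ i \<bullet> (x0 + 0) < d $ i"
        using x0 by (auto simp: mem_poly_set less_le)
      moreover have "((\<lambda>h. C $ i \<bullet> (x0 + h)) \<longlongrightarrow> C $ i \<bullet> (x0 + 0)) (nhds 0)"
        by (intro tendsto_intros filterlim_ident)
      ultimately show ?thesis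
        using order_tendstoD(2) by (fastforce elim: eventually_mono)
    qed simp
  qed
  then obtain \<eta> where \<eta>: "\<eta> > 0"
    "\<And>h. norm h < \<eta> \<Longrightarrow> \<forall>i. C $ i \<bullet> x0 \<noteq> d $ i \<longrightarrow> C $ i \<bullet> (x0 + h) < d $ i"
    unfolding eventually_nhds_metric by (auto simp: dist_norm)
  show ?thesis
  proof (rule that)
    show "0 \<le> L" by (rule L)
    \<comment> \<open>\<open>L + 1\<close> avoids division by zero when \<open>L\<close> is 0 and
      keeps the lifted direction shorter than \<eta>.\<close>
    show "0 < \<eta> / (L + 1)" using \<eta> L by simp
    fix w assume w: "w \<in> f ` poly_set C d" "norm (w - f x0) < \<eta> / (L + 1)"
    then obtain x where x: "x \<in> poly_set C d" "f x = w" by auto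
    \<comment> \<open>\<open>x\<close> may be far from \<open>x0\<close>; its direction lies in the
      cone, whose bounded lift then supplies a short one.\<close>
    have "x - x0 \<in> T"
      using x by (auto simp: T_def a_def mem_poly_set inner_diff_right)
    then have "w - f x0 \<in> f ` T"
      using x linear_diff [OF f] by (metis imageI)
    then obtain h where h: "h \<in> T" "f h = w - f x0" "norm h \<le> L * norm (w - f x0)"
      using L(2) by metis
    have "L * norm (w - f x0) \<le> (L + 1) * norm (w - f x0)"
      by (simp add: algebra_simps)
    also have "\<dots> < \<eta>"
      using w(2) L(1) by (simp add: pos_less_divide_eq mult.commute)
    finally have "norm h < \<eta>" using h(3) by simp
    have "C $ i \<bullet> (x0 + h) \<le> d $ i" for i
    proof (cases "C $ i \<bullet> x0 = d $ i")
      case True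
      then show ?thesis using h(1) by (auto simp: T_def a_def inner_add_right dest!: spec[of _ i])
    next
      case False
      then show ?thesis using \<eta>(2) [OF \<open>norm h < \<eta>\<close>] by (auto simp: less_imp_le)
    qed
    then have "x0 + h \<in> poly_set C d"
      by (simp add: mem_poly_set)
    then show "\<exists>u \<in> poly_set C d. f u = w \<and> norm (u - x0) \<le> L * norm (w - f x0)"
      using h by (intro bexI [of _ "x0 + h"]) (auto simp: linear_add [OF f])
  qed
qed

text \<open>The pairs obtained from nonnegative multipliers and a slack form a finitely generated,
  hence closed, cone. If it missed \<open>(g, \<gamma>)\<close>, a separating functional would
  contradict \<open>le\<close>.\<close>

lemma affine_farkas:
  fixes C :: "real^'n^'l"
  assumes ne: "poly_set C d \<noteq> {}" and le: "\<And>x. x \<in> poly_set C d \<Longrightarrow> g \<bullet> x \<le> \<gamma>"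
  obtains \<mu> where "0 \<le> \<mu>" "transpose C *v \<mu> = g" "d \<bullet> \<mu> \<le> \<gamma>"
proof -
  define T :: "((real^'l) \<times> real) set" where "T = {p. 0 \<le> fst p \<and> 0 \<le> snd p}"
  \<comment> \<open>\<open>snd p\<close> is the slack that turns the bound on
    \<open>d \<bullet> \<mu>\<close> into an equation.\<close>
  define f :: "(real^'l) \<times> real \<Rightarrow> (real^'n) \<times> real"
    where "f p = (transpose C *v fst p, d \<bullet> fst p + snd p)" for p
  have T_eq: "T = {p. \<forall>i. (- axis i 1, 0) \<bullet> p \<le> 0} \<inter> {p. (0, -1) \<bullet> p \<le> 0}"
    by (auto simp: T_def less_eq_vec_def inner_axis')
  have "polyhedron T"
    unfolding T_eq by (intro polyhedron_Int polyhedron_inequalities polyhedron_halfspace_le)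
  moreover have "convex_cone T"
    unfolding T_eq by (intro convex_cone_Int convex_cone_inequalities convex_cone_halfspace_le)
  moreover have lin: "linear f"
    by (auto simp: linear_iff f_def matrix_vector_right_distrib matrix_vector_mult_scaleR
        inner_add_right algebra_simps)
  ultimately have poly: "polyhedron (f ` T)" and cone: "convex_cone (f ` T)"
    by (auto intro: polyhedron_cone_linear_image convex_cone_linear_image)
  have "(g, \<gamma>) \<in> f ` T"
  proof (rule ccontr)
    assume "(g, \<gamma>) \<notin> f ` T"
    then obtain a \<beta> where a: "a \<bullet> (g, \<gamma>) < \<beta>" "\<And>q. q \<in> f ` T \<Longrightarrow> a \<bullet> q > \<beta>"
      using separating_hyperplane_closed_point polyhedron_imp_closed polyhedron_imp_convex poly
      by metis
    have "\<beta> < 0" using a(2) [OF convex_cone_contains_0 [OF cone]] by simp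
    \<comment> \<open>On a ray with negative values some multiple attains exactly \<beta>, which
      strict separation forbids.\<close>
    have pos: "a \<bullet> q \<ge> 0" if "q \<in> f ` T" for q
    proof (rule ccontr)
      assume neg: "\<not> a \<bullet> q \<ge> 0"
      have "(\<beta> / (a \<bullet> q)) *\<^sub>R q \<in> f ` T"
        using neg \<open>\<beta> < 0\<close> by (intro convex_cone_scaleR cone that) (simp add: divide_nonpos_neg)
      from a(2) [OF this] neg show False by simp
    qed
    obtain p t where pt: "a = (p, t)" by (cases a)
    have "f (0, 1) \<in> f ` T" by (simp add: T_def)
    from pos [OF this] have "t \<ge> 0" by (simp add: f_def pt)
    \<comment> \<open>Unit multipliers yield one inequality per constraint: for \<open>t > 0\<close>
      they place - p / t in the polyhedron, for \<open>t = 0\<close> they make - p a recession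
      direction.\<close>
    have row: "C $ i \<bullet> p + t * d $ i \<ge> 0" for i
    proof -
      have "f (axis i 1, 0) \<in> f ` T"
        by (auto simp: T_def less_eq_vec_def axis_def)
      from pos [OF this] have "p \<bullet> (transpose C *v axis i 1) + t * (d \<bullet> axis i 1) \<ge> 0"
        by (simp add: f_def pt)
      moreover have "p \<bullet> (transpose C *v axis i 1) = C $ i \<bullet> p"
        by (metis dot_lmul_matrix inner_axis' inner_commute inner_real_def matrix_vector_mul_component
            mult_1 transpose_matrix_vector)
      ultimately show ?thesis by (simp add: inner_axis)
    qed
    have neg: "p \<bullet> g + t * \<gamma> < 0"
      using a(1) \<open>\<beta> < 0\<close> by (simp add: pt)
    show False
    proof (cases "t = 0")
      case False
      then have "t > 0" using \<open>t \<ge> 0\<close> by simp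
      have "- (C $ i \<bullet> p) \<le> t * d $ i" for i
        using row [of i] by simp
      then have "(- (1 / t)) *\<^sub>R p \<in> poly_set C d"
        using \<open>t > 0\<close> by (auto simp: mem_poly_set field_simps)
      from le [OF this] neg \<open>t > 0\<close> show False
        by (simp add: field_simps inner_commute)
    next
      case True
      obtain x0 where x0: "x0 \<in> poly_set C d" using ne by auto
      \<comment> \<open>\<open>r\<close> carries \<open>x0\<close> far enough along - p for the
        value of \<open>g\<close> to exceed \<gamma> by at least 1; the absolute value keeps
        \<open>r\<close> nonnegative.\<close>
      define r where "r = (\<bar>\<gamma> - g \<bullet> x0\<bar> + 1) / (- (p \<bullet> g))"
      have "r \<ge> 0" unfolding r_def using neg True by (intro divide_nonneg_nonneg) auto
      have "x0 - r *\<^sub>R p \<in> poly_set C d"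
        using x0 row True \<open>r \<ge> 0\<close>
        by (auto simp: mem_poly_set inner_diff_right intro: order_trans [rotated])
      from le [OF this] have "g \<bullet> x0 - r * (p \<bullet> g) \<le> \<gamma>"
        by (simp add: inner_diff_right inner_commute)
      moreover have "r * (p \<bullet> g) = - (\<bar>\<gamma> - g \<bullet> x0\<bar> + 1)"
        using neg True by (simp add: r_def)
      ultimately show False by simp
    qed
  qed
  then obtain \<mu> s where "0 \<le> \<mu>" "0 \<le> s" "transpose C *v \<mu> = g" "d \<bullet> \<mu> + s = \<gamma>"
    by (auto simp: T_def f_def)
  then show ?thesis using that by simp
qed

section \<open>Norms and the BPDN-like dual problem\<close>

lemma is_normD:
  assumes "is_norm nrm"
  shows is_norm_nonneg: "0 \<le> nrm v"
    and is_norm_eq_0: "nrm v = 0 \<longleftrightarrow> v = 0"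
    and is_norm_scale: "nrm (c *\<^sub>R v) = \<bar>c\<bar> * nrm v"
    and is_norm_triangle: "nrm (u + v) \<le> nrm u + nrm v"
  using assms by (auto simp: is_norm_def)

lemma convex_on_is_norm:
  assumes nrm: "is_norm nrm"
  shows "convex_on UNIV nrm"
proof (rule convex_onI)
  fix t :: real and x y
  assume "0 < t" "t < 1"
  then show "nrm ((1 - t) *\<^sub>R x + t *\<^sub>R y) \<le> (1 - t) * nrm x + t * nrm y"
    using is_norm_triangle [OF nrm, of "(1 - t) *\<^sub>R x" "t *\<^sub>R y"]
    by (simp add: is_norm_scale [OF nrm])
qed simp

lemma continuous_on_is_norm: "is_norm nrm \<Longrightarrow> continuous_on S nrm"
  using convex_on_continuous [OF open_UNIV convex_on_is_norm] continuous_on_subset by blast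

text \<open>The constant is the minimum over the Euclidean unit sphere, attained by compactness and
  positive by definiteness.\<close>

lemma is_norm_bounds_norm:
  fixes nrm :: "real^'p \<Rightarrow> real"
  assumes nrm: "is_norm nrm"
  obtains c where "0 < c" "\<And>v. c * norm v \<le> nrm v"
proof -
  have ne: "sphere (0::real^'p) 1 \<noteq> {}" by simp
  obtain v0 where v0: "v0 \<in> sphere 0 1" "\<And>v. v \<in> sphere 0 1 \<Longrightarrow> nrm v0 \<le> nrm v"
    using continuous_attains_inf [OF compact_sphere ne continuous_on_is_norm [OF nrm]] by blast
  have "v0 \<noteq> 0" using v0(1) by auto
  then have "0 < nrm v0"
    using is_norm_nonneg [OF nrm, of v0] is_norm_eq_0 [OF nrm, of v0] by simp
  moreover have "nrm v0 * norm v \<le> nrm v" for v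
  proof (cases "v = 0")
    case False
    then have "nrm v0 \<le> nrm (v /\<^sub>R norm v)" by (intro v0) simp
    then show ?thesis using False by (simp add: is_norm_scale [OF nrm] field_simps)
  qed (simp add: is_norm_nonneg [OF nrm])
  ultimately show ?thesis using that by blast
qed

lemma compact_is_norm_ball:
  assumes nrm: "is_norm nrm"
  shows "compact {v. nrm v \<le> r}"
proof -
  obtain c where c: "0 < c" "\<And>v. c * norm v \<le> nrm v"
    using is_norm_bounds_norm [OF nrm] by blast
  have "norm v \<le> r / c" if "nrm v \<le> r" for v
    using order_trans [OF c(2) that] c(1) by (simp add: field_simps)
  then have "bounded {v. nrm v \<le> r}"
    by (auto simp: bounded_iff)
  moreover have "closed {v. nrm v \<le> r}"
    by (intro closed_Collect_le continuous_on_is_norm nrm continuous_intros)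
  ultimately show ?thesis by (simp add: compact_eq_bounded_closed)
qed

lemma convex_is_norm_ball:
  assumes nrm: "is_norm nrm"
  shows "convex {v. nrm v \<le> r}"
proof (rule convexI, clarify)
  fix x y and u v :: real
  assume *: "nrm x \<le> r" "nrm y \<le> r" "0 \<le> u" "0 \<le> v" "u + v = 1"
  have "nrm (u *\<^sub>R x + v *\<^sub>R y) \<le> u * nrm x + v * nrm y"
    using * is_norm_triangle [OF nrm, of "u *\<^sub>R x" "v *\<^sub>R y"] by (simp add: is_norm_scale [OF nrm])
  also have "\<dots> \<le> u * r + v * r"
    using * by (intro add_mono mult_left_mono)
  also have "\<dots> = r" using * by (simp flip: distrib_right)
  finally show "nrm (u *\<^sub>R x + v *\<^sub>R y) \<le> r" .
qed

text \<open>Compactness of the unit ball bounds the defining set, so \<open>Sup\<close> in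
  \<open>dual_norm\<close> is a genuine supremum.\<close>

lemma dual_norm_upper:
  fixes nrm :: "real^'p \<Rightarrow> real"
  assumes nrm: "is_norm nrm" and "nrm w \<le> 1"
  shows "v \<bullet> w \<le> dual_norm nrm v"
proof -
  have "bounded {w. nrm w \<le> 1}"
    using compact_is_norm_ball [OF nrm] compact_imp_bounded by blast
  then obtain K where K: "\<And>w. nrm w \<le> 1 \<Longrightarrow> norm w \<le> K"
    by (auto simp: bounded_iff)
  have "v \<bullet> w \<le> norm v * K" if "nrm w \<le> 1" for w
    using norm_cauchy_schwarz K [OF that] by (meson mult_left_mono norm_ge_zero order_trans)
  then have "bdd_above {v \<bullet> w | w. nrm w \<le> 1}"
    by (auto simp: bdd_above_def)
  then show ?thesis
    unfolding dual_norm_def using assms(2) by (intro cSup_upper) auto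
qed

lemma dual_norm_leI:
  assumes nrm: "is_norm nrm" and "\<And>w. nrm w \<le> 1 \<Longrightarrow> v \<bullet> w \<le> r"
  shows "dual_norm nrm v \<le> r"
proof -
  have "nrm 0 \<le> 1" using is_norm_eq_0 [OF nrm, of 0] by simp
  then show ?thesis
    unfolding dual_norm_def using assms(2) by (intro cSup_least) auto
qed

lemma dual_norm_pos:
  assumes nrm: "is_norm nrm" and "v \<noteq> 0"
  shows "0 < dual_norm nrm v"
proof -
  have pos: "0 < nrm v"
    using assms is_norm_nonneg [OF nrm, of v] is_norm_eq_0 [OF nrm, of v] by simp
  have "nrm ((1 / nrm v) *\<^sub>R v) \<le> 1"
    using pos by (simp add: is_norm_scale [OF nrm])
  from dual_norm_upper [OF nrm this, of v] have "(v \<bullet> v) / nrm v \<le> dual_norm nrm v"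
    by simp
  moreover have "0 < (v \<bullet> v) / nrm v" using pos assms(2) by simp
  ultimately show ?thesis by linarith
qed

lemma dual_norm_scale:
  assumes nrm: "is_norm nrm" and "0 < c"
  shows "dual_norm nrm (c *\<^sub>R v) \<le> c * dual_norm nrm v"
  using assms by (intro dual_norm_leI) (auto intro: mult_left_mono dual_norm_upper)

text \<open>The image of the polyhedron under \<open>x \<mapsto> (Ax, Ex)\<close> is closed and misses the compact convex
  set of pairs \<open>(u, w)\<close> with \<open>u\<close> within \<open>\<sigma>\<close> of \<open>b\<close> and \<open>w\<close> of norm at most half the optimal
  value. The separating functional, scaled so that its second component has dual norm 1,
  yields the dual point through Farkas' lemma.\<close>

lemma bpdn_dual_value_negative:
  fixes A :: "real^'n^'m" and E :: "real^'n^'p" and C :: "real^'n^'l"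
  assumes nrm: "is_norm nrm" and st: "bpdn_standing A b E C d nrm \<sigma>"
  obtains y \<mu> v where "dual_feasible A E C nrm (y, \<mu>, v)" "b \<bullet> y + \<sigma> * norm y + d \<bullet> \<mu> < 0"
proof -
  let ?P = "poly_set C d" and ?F = "bpdn_feasible_set A b C d \<sigma>"
  define p where "p = (INF x\<in>?F. nrm (E *v x)) / 2"
  have \<sigma>: "0 < \<sigma>" and ne: "?F \<noteq> {}" and p: "0 < p"
    using st by (auto simp: bpdn_standing_def p_def)
  have opt: "2 * p \<le> nrm (E *v x)" if "x \<in> ?F" for x
    unfolding p_def using that is_norm_nonneg [OF nrm]
    by (auto intro!: cINF_lower bdd_belowI2)
  define f where "f x = (A *v x, E *v x)" for x
  define K where "K = cball b \<sigma> \<times> {w. nrm w \<le> p}"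
  have lin: "linear f"
    by (auto simp: linear_iff f_def matrix_vector_right_distrib matrix_vector_mult_scaleR)
  \<comment> \<open>A common point would come from a BPDN-feasible \<open>x\<close> whose objective
    is at most \<open>p\<close>, half the positive optimal value.\<close>
  have "f ` ?P \<inter> K = {}"
    using opt p by (force simp: f_def K_def bpdn_feasible_set_def dist_norm norm_minus_commute)
  moreover have "(b, 0) \<in> K"
    using \<sigma> p is_norm_eq_0 [OF nrm, of 0] by (simp add: K_def)
  moreover have "compact K" "convex K"
    unfolding K_def
    by (auto intro!: compact_Times convex_Times compact_is_norm_ball convex_is_norm_ball nrm)
  moreover have "closed (f ` ?P)" "convex (f ` ?P)"
    using lin by (auto intro: closed_linear_image_poly_set convex_linear_image convex_poly_set)
  ultimately obtain a \<beta> where sep: "\<And>q. q \<in> K \<Longrightarrow> a \<bullet> q < \<beta>" "\<And>q. q \<in> f ` ?P \<Longrightarrow> \<beta> < a \<bullet> q"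
    using separating_hyperplane_compact_closed [of K "f ` ?P"] by (metis Int_commute empty_iff)
  obtain y v where a: "a = (y, v)" by (cases a)
  have P: "\<beta> < y \<bullet> (A *v x) + v \<bullet> (E *v x)" if "x \<in> ?P" for x
    using sep(2) [of "f x"] that by (simp add: f_def a)
  have K: "y \<bullet> u + v \<bullet> w < \<beta>" if "norm (u - b) \<le> \<sigma>" "nrm w \<le> p" for u w
    using sep(1) [of "(u, w)"] that by (simp add: K_def a dist_norm norm_minus_commute)
  \<comment> \<open>With \<open>v = 0\<close> the functional could not separate \<open>f x\<close>
    from \<open>(A *v x, 0)\<close> in \<open>K\<close> for a feasible \<open>x\<close>.\<close>
  have "v \<noteq> 0"
  proof
    assume "v = 0"
    obtain x where "x \<in> ?P" "norm (A *v x - b) \<le> \<sigma>"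
      using ne by (auto simp: bpdn_feasible_set_def)
    then show False
      using P [of x] K [of "A *v x" 0] \<open>v = 0\<close> p is_norm_eq_0 [OF nrm, of 0] by simp
  qed
  define \<delta> where "\<delta> = dual_norm nrm v"
  have \<delta>: "0 < \<delta>" unfolding \<delta>_def by (rule dual_norm_pos [OF nrm \<open>v \<noteq> 0\<close>])
  have bound: "y \<bullet> b + \<sigma> * norm y + p * \<delta> \<le> \<beta>"
  proof -
    \<comment> \<open>\<open>u\<close> maximises the product with \<open>y\<close> over the ball
      around \<open>b\<close>; for \<open>y = 0\<close> it is \<open>b\<close> itself, still a
      maximiser.\<close>
    define u where "u = b + (\<sigma> / norm y) *\<^sub>R y"
    have "norm (u - b) \<le> \<sigma>" using \<sigma> by (cases "y = 0") (auto simp: u_def)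
    have yu: "y \<bullet> u = y \<bullet> b + \<sigma> * norm y"
      by (cases "y = 0") (auto simp: u_def inner_add_right dot_square_norm power2_eq_square)
    \<comment> \<open>Scaling \<open>w\<close> by \<open>p\<close> reaches the ball used in
      \<open>K\<close>; the supremum over \<open>w\<close> then contributes
      \<open>p * \<delta>\<close>.\<close>
    have "v \<bullet> w \<le> (\<beta> - y \<bullet> u) / p" if "nrm w \<le> 1" for w
    proof -
      have "nrm (p *\<^sub>R w) \<le> p" using that p by (simp add: is_norm_scale [OF nrm])
      from K [OF \<open>norm (u - b) \<le> \<sigma>\<close> this] show ?thesis
        using p by (simp add: field_simps)
    qed
    then have "\<delta> \<le> (\<beta> - y \<bullet> u) / p"
      unfolding \<delta>_def by (rule dual_norm_leI [OF nrm])
    then show ?thesis using p yu by (simp add: field_simps)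
  qed
  define y' v' where "y' = (1 / \<delta>) *\<^sub>R y" and "v' = (1 / \<delta>) *\<^sub>R v"
  define g where "g = - (transpose A *v y' + transpose E *v v')"
  \<comment> \<open>Divided by \<delta>, the separation becomes a linear inequality on the
    polyhedron, for which Farkas' lemma provides the multiplier \<mu>.\<close>
  have "g \<bullet> x \<le> - (\<beta> / \<delta>)" if "x \<in> ?P" for x
  proof -
    have "g \<bullet> x = - ((y \<bullet> (A *v x) + v \<bullet> (E *v x)) / \<delta>)"
      by (simp add: g_def y'_def v'_def inner_add_left inner_diff_left dot_lmul_matrix
          add_divide_distrib)
    then show ?thesis using P [OF that] \<delta> by (simp add: divide_right_mono)
  qed
  moreover have "?P \<noteq> {}" using ne by (auto simp: bpdn_feasible_set_def)
  ultimately obtain \<mu> where \<mu>: "0 \<le> \<mu>" "transpose C *v \<mu> = g" "d \<bullet> \<mu> \<le> - (\<beta> / \<delta>)"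
    using affine_farkas by metis
  show ?thesis
  proof
    have "dual_norm nrm v' \<le> 1"
      using dual_norm_scale [OF nrm, of "1 / \<delta>" v] \<delta> by (simp add: v'_def \<delta>_def)
    then show "dual_feasible A E C nrm (y', \<mu>, v')"
      using \<mu> by (simp add: dual_feasible_def g_def)
    \<comment> \<open>The gain \<open>p * \<delta>\<close> in \<open>bound\<close> survives as - p
      in the dual value.\<close>
    have "b \<bullet> y' + \<sigma> * norm y' = (y \<bullet> b + \<sigma> * norm y) / \<delta>"
      using \<delta> by (simp add: y'_def inner_commute add_divide_distrib)
    also have "\<dots> \<le> (\<beta> - p * \<delta>) / \<delta>"
      using bound \<delta> by (intro divide_right_mono) auto
    also have "\<dots> = \<beta> / \<delta> - p" using \<delta> by (simp add: field_simps)
    finally show "b \<bullet> y' + \<sigma> * norm y' + d \<bullet> \<mu> < 0" using \<mu>(3) p by simp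
  qed
qed

text \<open>Keeps the normalisation in \<open>bpdn_rhs\<close> away from its singularity. Membership
  of 0 in the polyhedron means that \<open>d\<close> is nonnegative, so \<open>y = 0\<close> cannot
  give the negative value attained elsewhere.\<close>

lemma bpdn_dual_solution_nonzero:
  assumes nrm: "is_norm nrm" and st: "bpdn_standing A b E C d nrm \<sigma>"
    and sol: "bpdn_dual_solution A b E C d nrm \<sigma> y"
  shows "y \<noteq> 0"
proof
  assume "y = 0"
  with sol obtain \<mu> v
    where arg_min: "is_arg_min (\<lambda>(y, \<mu>, v). b \<bullet> y + \<sigma> * norm y + d \<bullet> \<mu>)
      (dual_feasible A E C nrm) (0, \<mu>, v)"
    unfolding bpdn_dual_solution_def by blast
  then have feas: "dual_feasible A E C nrm (0, \<mu>, v)"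
    by (simp add: is_arg_min_def)
  have min: "d \<bullet> \<mu> \<le> b \<bullet> y' + \<sigma> * norm y' + d \<bullet> \<mu>'"
    if "dual_feasible A E C nrm (y', \<mu>', v')" for y' \<mu>' v'
    using arg_min that by (auto simp: is_arg_min_def not_less)
  have "0 \<le> \<mu> $ i" "0 \<le> d $ i" for i
    using feas st by (auto simp: dual_feasible_def bpdn_standing_def mem_poly_set less_eq_vec_def)
  then have "0 \<le> d \<bullet> \<mu>" by (simp add: inner_vec_def sum_nonneg)
  moreover obtain y' \<mu>' v' where "dual_feasible A E C nrm (y', \<mu>', v')"
    "b \<bullet> y' + \<sigma> * norm y' + d \<bullet> \<mu>' < 0"
    using bpdn_dual_value_negative [OF nrm st] .
  ultimately show False using min [of y' \<mu>' v'] by simp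
qed

section \<open>The regularized problem\<close>

definition reg_objective ::
  "real^'n^'p \<Rightarrow> (real^'p \<Rightarrow> real) \<Rightarrow> real \<Rightarrow> real^'n \<Rightarrow> real" where
  "reg_objective E nrm \<alpha> x = nrm (E *v x) + \<alpha> / 2 * (norm x)\<^sup>2"

lemma reg_bp_solution_iff:
  "reg_bp_solution A E C d nrm \<alpha> w x \<longleftrightarrow>
     A *v x = w \<and> x \<in> poly_set C d \<and>
     (\<forall>u \<in> poly_set C d. A *v u = w \<longrightarrow> reg_objective E nrm \<alpha> x \<le> reg_objective E nrm \<alpha> u)"
  by (auto simp: reg_bp_solution_def is_arg_min_def reg_objective_def not_less)

section \<open>Existence, uniqueness and stability of the minimiser\<close>

lemma continuous_on_reg_objective:
  assumes "is_norm nrm"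
  shows "continuous_on S (reg_objective E nrm \<alpha>)"
  unfolding reg_objective_def
  by (intro continuous_intros continuous_on_compose2 [OF continuous_on_is_norm [OF assms, of UNIV]]
      linear_continuous_on linear_linear [THEN iffD1]) auto

text \<open>The quadratic term alone bounds \<open>x\<close>, since the norm term is
  nonnegative.\<close>

lemma compact_reg_objective_sublevel:
  assumes nrm: "is_norm nrm" and \<alpha>: "0 < \<alpha>"
  shows "compact {x. reg_objective E nrm \<alpha> x \<le> r}"
proof -
  have "norm x \<le> sqrt (2 * r / \<alpha>)" if "reg_objective E nrm \<alpha> x \<le> r" for x
  proof (rule real_le_rsqrt)
    have "\<alpha> / 2 * (norm x)\<^sup>2 \<le> r"
      using that is_norm_nonneg [OF nrm, of "E *v x"] by (simp add: reg_objective_def)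
    then show "(norm x)\<^sup>2 \<le> 2 * r / \<alpha>" using \<alpha> by (simp add: field_simps)
  qed
  then have "bounded {x. reg_objective E nrm \<alpha> x \<le> r}"
    by (auto simp: bounded_iff)
  moreover have "closed {x. reg_objective E nrm \<alpha> x \<le> r}"
    by (intro closed_Collect_le continuous_on_reg_objective nrm continuous_intros)
  ultimately show ?thesis by (simp add: compact_eq_bounded_closed)
qed

lemma closed_reg_bp_feasible: "closed {x \<in> poly_set C d. A *v x = w}"
proof -
  have "closed {x. A *v x = w}"
    by (intro closed_Collect_eq linear_continuous_on linear_linear [THEN iffD1] continuous_intros) auto
  then have "closed (poly_set C d \<inter> {x. A *v x = w})"
    by (simp add: closed_Int polyhedron_imp_closed polyhedron_poly_set)
  then show ?thesis by (simp add: Int_def)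
qed

lemma reg_bp_solution_exists:
  assumes nrm: "is_norm nrm" and \<alpha>: "0 < \<alpha>" and w: "w \<in> (\<lambda>u. A *v u) ` poly_set C d"
  obtains x where "reg_bp_solution A E C d nrm \<alpha> w x"
proof -
  let ?f = "reg_objective E nrm \<alpha>" and ?S = "{x \<in> poly_set C d. A *v x = w}"
  obtain x0 where x0: "x0 \<in> ?S" using w by auto
  \<comment> \<open>Cutting down to the sublevel set of a feasible point gives compactness without
    losing any minimiser.\<close>
  define K where "K = ?S \<inter> {x. ?f x \<le> ?f x0}"
  have "compact K"
    unfolding K_def
    by (intro closed_Int_compact closed_reg_bp_feasible compact_reg_objective_sublevel nrm \<alpha>)
  moreover have "K \<noteq> {}" using x0 by (auto simp: K_def)
  ultimately obtain x where x: "x \<in> K" "\<forall>u\<in>K. ?f x \<le> ?f u"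
    using continuous_attains_inf [OF _ _ continuous_on_reg_objective [OF nrm]] by meson
  have "?f x \<le> ?f u" if "u \<in> ?S" for u
    using x that by (cases "?f u \<le> ?f x0") (auto simp: K_def)
  then have "reg_bp_solution A E C d nrm \<alpha> w x"
    using x(1) by (auto simp: reg_bp_solution_iff K_def)
  then show ?thesis by (rule that)
qed

text \<open>Strong convexity at the midpoint: the triangle inequality handles the norm, the
  parallelogram law the square, and \<alpha>/2 times 1/4 gives \<alpha>/8.\<close>

lemma reg_objective_midpoint:
  assumes nrm: "is_norm nrm"
  shows "reg_objective E nrm \<alpha> ((1/2) *\<^sub>R (x + u)) + \<alpha> / 8 * (norm (x - u))\<^sup>2
    \<le> (reg_objective E nrm \<alpha> x + reg_objective E nrm \<alpha> u) / 2"
proof -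
  have "nrm (E *v ((1/2) *\<^sub>R (x + u))) \<le> (nrm (E *v x) + nrm (E *v u)) / 2"
    using is_norm_triangle [OF nrm, of "E *v x" "E *v u"]
    by (simp add: matrix_vector_mult_scaleR is_norm_scale [OF nrm] matrix_vector_right_distrib)
  moreover have "(norm ((1/2) *\<^sub>R (x + u)))\<^sup>2 + (norm (x - u))\<^sup>2 / 4 = ((norm x)\<^sup>2 + (norm u)\<^sup>2) / 2"
  proof -
    have "(norm ((1/2) *\<^sub>R (x + u)))\<^sup>2 = ((norm x)\<^sup>2 + (norm u)\<^sup>2 + 2 * (x \<bullet> u)) / 4"
      by (simp add: power2_norm_eq_inner inner_add_left inner_add_right inner_commute
          del: norm_scaleR)
    moreover have "(norm (x - u))\<^sup>2 = (norm x)\<^sup>2 + (norm u)\<^sup>2 - 2 * (x \<bullet> u)"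
      by (simp add: power2_norm_eq_inner inner_diff_left inner_diff_right inner_commute)
    ultimately show ?thesis by (simp only:) (simp add: field_simps)
  qed
  then have "\<alpha> / 2 * ((norm ((1/2) *\<^sub>R (x + u)))\<^sup>2 + (norm (x - u))\<^sup>2 / 4)
      = \<alpha> / 2 * (((norm x)\<^sup>2 + (norm u)\<^sup>2) / 2)"
    by simp
  ultimately show ?thesis
    by (simp add: reg_objective_def algebra_simps)
qed

text \<open>The midpoint of two solutions is feasible, and strong convexity would make it strictly
  better if they differed.\<close>

lemma reg_bp_solution_unique:
  assumes nrm: "is_norm nrm" and \<alpha>: "0 < \<alpha>"
    and x: "reg_bp_solution A E C d nrm \<alpha> w x" and u: "reg_bp_solution A E C d nrm \<alpha> w u"
  shows "x = u"
proof -
  let ?f = "reg_objective E nrm \<alpha>"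
  have "?f x = ?f u"
    using x u by (intro antisym) (auto simp: reg_bp_solution_iff)
  have "(1/2) *\<^sub>R (x + u) \<in> poly_set C d"
    using x u convexD [OF convex_poly_set, of x C d u "1/2" "1/2"]
    by (auto simp: reg_bp_solution_iff scaleR_add_right)
  moreover have "A *v ((1/2) *\<^sub>R (x + u)) = w"
    using x u by (simp add: reg_bp_solution_iff matrix_vector_mult_scaleR matrix_vector_right_distrib
        flip: scaleR_2)
  ultimately have "?f x \<le> ?f ((1/2) *\<^sub>R (x + u))"
    using x by (simp add: reg_bp_solution_iff)
  with reg_objective_midpoint [OF nrm, of E \<alpha> x u] \<open>?f x = ?f u\<close>
  have "\<alpha> / 8 * (norm (x - u))\<^sup>2 \<le> 0" by simp
  then show ?thesis using \<alpha> by (simp add: mult_le_0_iff)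
qed

lemma ex1_reg_bp_solution:
  assumes "is_norm nrm" "0 < \<alpha>" "w \<in> (\<lambda>u. A *v u) ` poly_set C d"
  shows "\<exists>!u. reg_bp_solution A E C d nrm \<alpha> w u"
  using reg_bp_solution_exists [OF assms] reg_bp_solution_unique [OF assms(1,2)] by metis

lemma the_reg_bp_solution:
  assumes "is_norm nrm" "0 < \<alpha>" "w \<in> (\<lambda>u. A *v u) ` poly_set C d"
  shows "reg_bp_solution A E C d nrm \<alpha> w (the_reg_bp_solution A E C d nrm \<alpha> w)"
  unfolding the_reg_bp_solution_def by (rule theI') (rule ex1_reg_bp_solution [OF assms])

text \<open>Feasible comparison points converging to \<open>x\<close> bound the limiting values at
  \<open>z k\<close> by the optimal one; compactness and uniqueness then force every cluster point
  to be \<open>x\<close>.\<close>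

lemma reg_bp_solution_tendsto:
  fixes z :: "nat \<Rightarrow> real^'n"
  assumes nrm: "is_norm nrm" and \<alpha>: "0 < \<alpha>"
    and x: "reg_bp_solution A E C d nrm \<alpha> w x"
    and z: "\<forall>\<^sub>F k in sequentially. reg_bp_solution A E C d nrm \<alpha> (v k) (z k)"
    and v: "v \<longlonglongrightarrow> w"
  shows "z \<longlonglongrightarrow> x"
proof -
  let ?f = "reg_objective E nrm \<alpha>" and ?P = "poly_set C d"
  have xP: "x \<in> ?P" and Ax: "A *v x = w" using x by (auto simp: reg_bp_solution_iff)
  obtain L \<delta> where "0 \<le> L" "0 < \<delta>" and lift:
    "\<And>w'. \<lbrakk>w' \<in> (\<lambda>u. A *v u) ` ?P; norm (w' - w) < \<delta>\<rbrakk>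
        \<Longrightarrow> \<exists>u \<in> ?P. A *v u = w' \<and> norm (u - x) \<le> L * norm (w' - w)"
    using poly_set_local_lift [of "\<lambda>u. A *v u" x C d] xP Ax by auto
  have "\<forall>\<^sub>F k in sequentially. norm (v k - w) < \<delta>"
    using tendstoD [OF v \<open>0 < \<delta>\<close>] by (simp add: dist_norm)
  \<comment> \<open>For each late \<open>k\<close> the local lift finds a point near
    \<open>x\<close> that is admissible for \<open>v k\<close>; \<open>z k\<close> is at least as
    good.\<close>
  with z have "\<forall>\<^sub>F k in sequentially. \<exists>u \<in> ?P. A *v u = v k \<and> norm (u - x) \<le> L * norm (v k - w)"
  proof eventually_elim
    case (elim k)
    then show ?case by (intro lift) (auto simp: reg_bp_solution_iff image_iff intro!: bexI [of _ "z k"])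
  qed
  then obtain u where u: "\<forall>\<^sub>F k in sequentially.
      u k \<in> ?P \<and> A *v u k = v k \<and> norm (u k - x) \<le> L * norm (v k - w)"
    unfolding Bex_def eventually_ex by blast
  have "(\<lambda>k. u k - x) \<longlonglongrightarrow> 0"
  proof (rule Lim_null_comparison)
    show "\<forall>\<^sub>F k in sequentially. norm (u k - x) \<le> L * norm (v k - w)"
      using u by eventually_elim simp
    show "(\<lambda>k. L * norm (v k - w)) \<longlonglongrightarrow> 0"
      using v by (intro tendsto_mult_right_zero tendsto_norm_zero) (simp add: LIM_zero)
  qed
  then have "u \<longlonglongrightarrow> x" by (rule LIM_zero_cancel)
  then have fu: "(\<lambda>k. ?f (u k)) \<longlonglongrightarrow> ?f x"
    by (rule continuous_on_tendsto_compose [OF continuous_on_reg_objective [OF nrm, of UNIV]]) auto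
  have fz: "\<forall>\<^sub>F k in sequentially. ?f (z k) \<le> ?f (u k)"
    using z u by eventually_elim (auto simp: reg_bp_solution_iff)
  define K where "K = {y. ?f y \<le> ?f x + 1}"
  have "compact K"
    unfolding K_def by (rule compact_reg_objective_sublevel [OF nrm \<alpha>])
  have "\<forall>\<^sub>F k in sequentially. ?f (u k) < ?f x + 1"
    using fu by (rule order_tendstoD) simp
  with fz have zK: "\<forall>\<^sub>F k in sequentially. z k \<in> K"
    by eventually_elim (simp add: K_def)
  show ?thesis
  proof (rule tendstoI, rule ccontr)
    fix e :: real
    assume "0 < e" and "\<not> (\<forall>\<^sub>F k in sequentially. dist (z k) x < e)"
    then have "\<exists>\<^sub>F k in sequentially. \<not> dist (z k) x < e"
      by (simp add: not_eventually)
    then have "\<exists>\<^sub>F k in sequentially. z k \<in> K \<and> \<not> dist (z k) x < e"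
      using frequently_eventually_conj [OF _ zK] by blast
    \<comment> \<open>Enumerating the violating indices and extracting a convergent part inside
      \<open>K\<close> gives a limit \<open>l\<close> at distance at least \<open>e\<close> from
      \<open>x\<close>.\<close>
    then have "infinite {k. z k \<in> K \<and> \<not> dist (z k) x < e}"
      by (simp add: frequently_cofinite flip: cofinite_eq_sequentially)
    then obtain r :: "nat \<Rightarrow> nat"
      where r: "strict_mono r" "\<And>n. z (r n) \<in> K \<and> \<not> dist (z (r n)) x < e"
      using infinite_enumerate by (metis (mono_tags, lifting) mem_Collect_eq)
    then obtain l s where "l \<in> K" "strict_mono s" and zl: "(\<lambda>n. z (r (s n))) \<longlonglongrightarrow> l"
      using seq_compactE [OF compact_imp_seq_compact [OF \<open>compact K\<close>], of "\<lambda>n. z (r n)"]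
      by (auto simp: comp_def)
    define t where "t n = r (s n)" for n
    have t: "filterlim t sequentially sequentially"
      unfolding t_def
      by (rule filterlim_subseq) (rule strict_mono_compose [OF r(1) \<open>strict_mono s\<close>])
    have zt: "(\<lambda>n. z (t n)) \<longlonglongrightarrow> l" using zl by (simp add: t_def)
    have ev: "\<forall>\<^sub>F n in sequentially. reg_bp_solution A E C d nrm \<alpha> (v (t n)) (z (t n))"
      using z t by (rule eventually_compose_filterlim)
    have "l \<in> ?P"
    proof (rule Lim_in_closed_set [OF _ _ _ zt])
      show "closed ?P" by (simp add: polyhedron_imp_closed polyhedron_poly_set)
      show "\<forall>\<^sub>F n in sequentially. z (t n) \<in> ?P"
        using ev by eventually_elim (simp add: reg_bp_solution_iff)
    qed simp
    moreover have "A *v l = w"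
    proof (rule tendsto_unique)
      show "(\<lambda>n. A *v z (t n)) \<longlonglongrightarrow> A *v l"
        by (rule bounded_linear.tendsto [OF matrix_vector_mul_bounded_linear zt])
      show "(\<lambda>n. A *v z (t n)) \<longlonglongrightarrow> w"
      proof (rule Lim_transform_eventually)
        show "(\<lambda>n. v (t n)) \<longlonglongrightarrow> w" using v t by (rule filterlim_compose)
        show "\<forall>\<^sub>F n in sequentially. v (t n) = A *v z (t n)"
          using ev by eventually_elim (simp add: reg_bp_solution_iff)
      qed
    qed simp
    moreover have "?f l \<le> ?f x"
    proof (rule tendsto_le)
      show "(\<lambda>n. ?f (u (t n))) \<longlonglongrightarrow> ?f x" using fu t by (rule filterlim_compose)
      show "(\<lambda>n. ?f (z (t n))) \<longlonglongrightarrow> ?f l"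
        by (rule continuous_on_tendsto_compose [OF continuous_on_reg_objective [OF nrm, of UNIV] zt])
          auto
      show "\<forall>\<^sub>F n in sequentially. ?f (z (t n)) \<le> ?f (u (t n))"
        using fz t by (rule eventually_compose_filterlim)
    qed simp
    ultimately have "reg_bp_solution A E C d nrm \<alpha> w l"
      using x by (auto simp: reg_bp_solution_iff intro: order_trans)
    then have "l = x" using reg_bp_solution_unique [OF nrm \<alpha> _ x] by blast
    moreover have "e \<le> dist l x"
    proof (rule tendsto_lowerbound)
      show "(\<lambda>n. dist (z (t n)) x) \<longlonglongrightarrow> dist l x" by (intro tendsto_intros zt)
      show "\<forall>\<^sub>F n in sequentially. e \<le> dist (z (t n)) x"
        using r(2) by (simp add: t_def not_less)
    qed simp
    ultimately show False using \<open>0 < e\<close> by simp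
  qed
qed

section \<open>Lipschitz dependence for the \<open>\<ell>\<^sub>1\<close>-norm\<close>

text \<open>A relative interior point has room in every direction of the affine hull, so injectivity
  on \<open>R\<close> passes to the direction space, where an injective linear map is bounded
  below.\<close>

lemma linear_inj_on_convex_lipschitz:
  fixes f :: "'a::euclidean_space \<Rightarrow> 'b::euclidean_space"
  assumes f: "linear f" and R: "convex R" and inj: "inj_on f R"
  obtains L where "0 \<le> L" "\<And>x y. \<lbrakk>x \<in> R; y \<in> R\<rbrakk> \<Longrightarrow> norm (x - y) \<le> L * norm (f x - f y)"
proof (cases "R = {}")
  case True
  then show ?thesis using that [of 0] by simp
next
  case False
  then obtain c where "c \<in> rel_interior R"
    using rel_interior_eq_empty [OF R] by blast
  then obtain e where c: "c \<in> R" "0 < e" "cball c e \<inter> affine hull R \<subseteq> R"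
    by (auto simp: mem_rel_interior_cball)
  define V where "V = span ((\<lambda>x. - c + x) ` R)"
  have hull: "affine hull R = (+) c ` V"
    unfolding V_def using affine_hull_span_gen [OF hull_inc [OF c(1)]] by simp
  have "v = 0" if "v \<in> V" "f v = 0" for v
  proof (rule ccontr)
    assume "v \<noteq> 0"
    \<comment> \<open>The step has length exactly \<open>e\<close>, so \<open>c\<close> moves
      without leaving \<open>R\<close>.\<close>
    define t where "t = e / norm v"
    have "t *\<^sub>R v \<in> V" using that by (simp add: V_def span_scale)
    then have "c + t *\<^sub>R v \<in> cball c e \<inter> affine hull R"
      using \<open>v \<noteq> 0\<close> c(2) by (auto simp: hull t_def dist_norm)
    then have "c + t *\<^sub>R v \<in> R" using c(3) by blast
    moreover have "f (c + t *\<^sub>R v) = f c"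
      using that by (simp add: linear_add [OF f] linear_cmul [OF f])
    ultimately have "c + t *\<^sub>R v = c"
      using inj_onD [OF inj] c(1) by blast
    then show False using \<open>v \<noteq> 0\<close> c(2) by (simp add: t_def)
  qed
  then obtain b where b: "0 < b" "\<And>v. v \<in> V \<Longrightarrow> b * norm v \<le> norm (f v)"
    using injective_imp_isometric [of V f] f
    by (auto simp: V_def closed_span linear_conv_bounded_linear)
  have "norm (x - y) \<le> 1 / b * norm (f x - f y)" if "x \<in> R" "y \<in> R" for x y
  proof -
    have "(- c + x) - (- c + y) \<in> V"
      unfolding V_def using that by (intro span_diff span_base) auto
    from b(2) [OF this] b(1) show ?thesis
      by (simp add: linear_diff [OF f] field_simps)
  qed
  with b(1) show ?thesis by (intro that [of "1 / b"]) auto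
qed

text \<open>Pieces whose closure avoids \<open>x\<^sub>0\<close> are absent near \<open>x\<^sub>0\<close>; on the others the Lipschitz bound
  extends to the closure.\<close>

lemma finite_union_convex_calm:
  fixes f :: "'a::euclidean_space \<Rightarrow> 'b::euclidean_space"
  assumes f: "linear f" and fin: "finite \<R>"
    and R: "\<And>R. R \<in> \<R> \<Longrightarrow> convex R" "\<And>R. R \<in> \<R> \<Longrightarrow> inj_on f R"
  obtains L where "0 \<le> L" "\<forall>\<^sub>F u in nhds x0. u \<in> \<Union>\<R> \<longrightarrow> norm (u - x0) \<le> L * norm (f u - f x0)"
proof -
  have "\<exists>L\<ge>0. \<forall>x\<in>R. \<forall>y\<in>R. norm (x - y) \<le> L * norm (f x - f y)" if "R \<in> \<R>" for R
    using linear_inj_on_convex_lipschitz [OF f R(1) R(2)] that by metis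
  then obtain M where M: "\<And>R. R \<in> \<R> \<Longrightarrow> 0 \<le> M R"
    "\<And>R x y. \<lbrakk>R \<in> \<R>; x \<in> R; y \<in> R\<rbrakk> \<Longrightarrow> norm (x - y) \<le> M R * norm (f x - f y)"
    by metis
  \<comment> \<open>A sum bounds all the constants at once and also covers an empty family.\<close>
  define L where "L = sum M \<R>"
  have "0 \<le> L" unfolding L_def using M(1) by (rule sum_nonneg)
  have M_le: "M R \<le> L" if "R \<in> \<R>" for R
    unfolding L_def using that M(1) fin by (intro member_le_sum) auto
  have "\<forall>\<^sub>F u in nhds x0. u \<in> R \<longrightarrow> norm (u - x0) \<le> L * norm (f u - f x0)" if "R \<in> \<R>" for R
  proof (cases "x0 \<in> closure R")
    case False
    then have "\<forall>\<^sub>F u in nhds x0. u \<in> - closure R"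
      by (intro eventually_nhds_in_open) auto
    then show ?thesis
      by eventually_elim (use closure_subset in auto)
  next
    case True
    have "norm (u - x0) \<le> L * norm (f u - f x0)" if "u \<in> R" for u
    proof -
      have "R \<subseteq> {y. norm (u - y) \<le> M R * norm (f u - f y)}"
        using M(2) \<open>R \<in> \<R>\<close> that by blast
      moreover have "closed {y. norm (u - y) \<le> M R * norm (f u - f y)}"
        using f by (intro closed_Collect_le continuous_intros linear_continuous_on)
          (auto simp: linear_conv_bounded_linear)
      ultimately have "norm (u - x0) \<le> M R * norm (f u - f x0)"
        using True closure_minimal by blast
      also have "\<dots> \<le> L * norm (f u - f x0)"
        using M_le [OF \<open>R \<in> \<R>\<close>] by (rule mult_right_mono) simp
      finally show ?thesis .
    qed
    then show ?thesis by simp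
  qed
  then have "\<forall>\<^sub>F u in nhds x0. \<forall>R\<in>\<R>. u \<in> R \<longrightarrow> norm (u - x0) \<le> L * norm (f u - f x0)"
    using fin by (intro eventually_ball_finite) auto
  then have "\<forall>\<^sub>F u in nhds x0. u \<in> \<Union>\<R> \<longrightarrow> norm (u - x0) \<le> L * norm (f u - f x0)"
    by eventually_elim auto
  with \<open>0 \<le> L\<close> show ?thesis by (rule that)
qed

text \<open>The one-sided directional derivative of the l1-norm at \<open>a\<close> in direction
  \<open>h\<close>.\<close>

definition l1_slope :: "real^'p \<Rightarrow> real^'p \<Rightarrow> real" where
  "l1_slope a h = (\<Sum>i\<in>UNIV. if a $ i = 0 then \<bar>h $ i\<bar> else sgn (a $ i) * h $ i)"

text \<open>A convex function lies above its one-sided linearisation; here this is checked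
  coordinatewise.\<close>

lemma l1_norm_add_ge: "l1_norm a + l1_slope a h \<le> l1_norm (a + h)"
  unfolding l1_norm_def l1_slope_def sum.distrib [symmetric]
  by (intro sum_mono) (auto simp: sgn_if)

lemma abs_add_small:
  fixes a u :: real
  assumes "a \<noteq> 0 \<Longrightarrow> \<bar>u\<bar> < \<bar>a\<bar>"
  shows "\<bar>a + u\<bar> = \<bar>a\<bar> + (if a = 0 then \<bar>u\<bar> else sgn a * u)"
  using assms by (auto simp: sgn_if abs_if split: if_splits)

text \<open>The norm is piecewise linear: for small \<open>t\<close> nonzero coordinates keep their
  signs, so the first-order expansion is exact.\<close>

lemma l1_norm_add_small:
  "\<forall>\<^sub>F t in at_right 0. l1_norm (a + t *\<^sub>R h) = l1_norm a + t * l1_slope a h"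
proof -
  have "\<forall>\<^sub>F t in at_right 0. \<forall>i. a $ i \<noteq> 0 \<longrightarrow> \<bar>t * h $ i\<bar> < \<bar>a $ i\<bar>"
  proof (rule eventually_all_finite)
    fix i
    have "((\<lambda>t. \<bar>t * h $ i\<bar>) \<longlongrightarrow> \<bar>0 * h $ i\<bar>) (at_right 0)"
      by (intro tendsto_intros)
    from order_tendstoD(2) [OF this, of "\<bar>a $ i\<bar>"]
    show "\<forall>\<^sub>F t in at_right 0. a $ i \<noteq> 0 \<longrightarrow> \<bar>t * h $ i\<bar> < \<bar>a $ i\<bar>"
      by (cases "a $ i = 0") auto
  qed
  moreover have "\<forall>\<^sub>F t::real in at_right 0. 0 < t"
    by (simp add: eventually_at_right_less)
  ultimately show ?thesis
  proof eventually_elim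
    case (elim t)
    have "\<bar>a $ i + t * h $ i\<bar> = \<bar>a $ i\<bar> + t * (if a $ i = 0 then \<bar>h $ i\<bar> else sgn (a $ i) * h $ i)" for i
      using abs_add_small [of "a $ i" "t * h $ i"] elim by (simp add: abs_mult)
    then show ?case
      by (simp add: l1_norm_def l1_slope_def sum_distrib_left sum.distrib)
  qed
qed

lemma l1_slope_cong: "(\<And>i. sgn (a $ i) = sgn (b $ i)) \<Longrightarrow> l1_slope a h = l1_slope b h"
  unfolding l1_slope_def by (intro sum.cong refl) (metis sgn_0_0)

text \<open>Both the admissible directions and the slope of the \<open>\<ell>\<^sub>1\<close> term depend on \<open>x\<close> only through its
  active constraints and the signs of \<open>E x\<close>.\<close>

lemma reg_bp_l1_optimal_iff:
  fixes A :: "real^'n^'m" and E :: "real^'n^'p" and C :: "real^'n^'l"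
  assumes \<alpha>: "0 < \<alpha>"
  shows "reg_bp_solution A E C d l1_norm \<alpha> (A *v x) x \<longleftrightarrow>
    x \<in> poly_set C d \<and>
    (\<forall>h. A *v h = 0 \<and> (\<forall>i. C $ i \<bullet> x = d $ i \<longrightarrow> C $ i \<bullet> h \<le> 0)
        \<longrightarrow> 0 \<le> \<alpha> * (x \<bullet> h) + l1_slope (E *v x) (E *v h))"
    (is "?sol \<longleftrightarrow> ?P \<and> (\<forall>h. ?adm h \<longrightarrow> ?slope h)")
proof (intro iffI conjI allI impI; (elim conjE)?)
  assume ?sol
  then show ?P by (simp add: reg_bp_solution_iff)
next
  fix h
  assume ?sol and adm: "A *v h = 0" "\<forall>i. C $ i \<bullet> x = d $ i \<longrightarrow> C $ i \<bullet> h \<le> 0"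
  then have P: ?P by (simp add: reg_bp_solution_iff)
  \<comment> \<open>Active constraints allow every positive step along \<open>h\<close>, slack ones
    every sufficiently short step.\<close>
  have "\<forall>\<^sub>F t in at_right 0. \<forall>i. C $ i \<bullet> (x + t *\<^sub>R h) \<le> d $ i"
  proof (rule eventually_all_finite)
    fix i
    have pos: "\<forall>\<^sub>F t::real in at_right 0. 0 < t"
      by (simp add: eventually_at_right_less)
    show "\<forall>\<^sub>F t in at_right 0. C $ i \<bullet> (x + t *\<^sub>R h) \<le> d $ i"
    proof (cases "C $ i \<bullet> x = d $ i")
      case True
      then show ?thesis
        using pos adm(2) by (auto elim!: eventually_mono simp: inner_add_right mult_nonneg_nonpos)
    next
      case False
      then have "C $ i \<bullet> (x + 0 *\<^sub>R h) < d $ i"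
        using P by (auto simp: mem_poly_set less_le)
      moreover have "((\<lambda>t. C $ i \<bullet> (x + t *\<^sub>R h)) \<longlongrightarrow> C $ i \<bullet> (x + 0 *\<^sub>R h)) (at_right 0)"
        by (intro tendsto_intros)
      ultimately have "\<forall>\<^sub>F t in at_right 0. C $ i \<bullet> (x + t *\<^sub>R h) < d $ i"
        by (rule order_tendstoD(2) [rotated])
      then show ?thesis by eventually_elim simp
    qed
  qed
  moreover have "\<forall>\<^sub>F t::real in at_right 0. 0 < t"
    by (simp add: eventually_at_right_less)
  moreover have "\<forall>\<^sub>F t in at_right 0. l1_norm (E *v x + t *\<^sub>R (E *v h))
      = l1_norm (E *v x) + t * l1_slope (E *v x) (E *v h)"
    by (rule l1_norm_add_small)
  \<comment> \<open>This is optimality against \<open>x + t *\<^sub>R h\<close> divided by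
    \<open>t\<close>; the last term vanishes as \<open>t\<close> tends to 0.\<close>
  ultimately have "\<forall>\<^sub>F t in at_right 0.
      0 \<le> \<alpha> * (x \<bullet> h) + l1_slope (E *v x) (E *v h) + t * (\<alpha> / 2 * (norm h)\<^sup>2)"
  proof eventually_elim
    case (elim t)
    then have "x + t *\<^sub>R h \<in> poly_set C d" by (simp add: mem_poly_set)
    moreover have "A *v (x + t *\<^sub>R h) = A *v x"
      using adm(1) by (simp add: matrix_vector_right_distrib matrix_vector_mult_scaleR)
    ultimately have "reg_objective E l1_norm \<alpha> x \<le> reg_objective E l1_norm \<alpha> (x + t *\<^sub>R h)"
      using \<open>?sol\<close> by (auto simp: reg_bp_solution_iff)
    moreover have "(norm (x + t *\<^sub>R h))\<^sup>2 = (norm x)\<^sup>2 + 2 * t * (x \<bullet> h) + t\<^sup>2 * (norm h)\<^sup>2"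
      by (simp add: power2_norm_eq_inner inner_add_left inner_add_right inner_commute
          power2_eq_square [of t] algebra_simps)
    moreover have "E *v (x + t *\<^sub>R h) = E *v x + t *\<^sub>R (E *v h)"
      by (simp add: matrix_vector_right_distrib matrix_vector_mult_scaleR)
    ultimately have "0 \<le> t * (\<alpha> * (x \<bullet> h) + l1_slope (E *v x) (E *v h) + t * (\<alpha> / 2 * (norm h)\<^sup>2))"
      using elim(3) by (simp add: reg_objective_def algebra_simps power2_eq_square)
    then show ?case using elim(2) by (simp add: zero_le_mult_iff)
  qed
  moreover have "((\<lambda>t. \<alpha> * (x \<bullet> h) + l1_slope (E *v x) (E *v h) + t * (\<alpha> / 2 * (norm h)\<^sup>2))
      \<longlongrightarrow> \<alpha> * (x \<bullet> h) + l1_slope (E *v x) (E *v h) + 0 * (\<alpha> / 2 * (norm h)\<^sup>2)) (at_right 0)"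
    by (intro tendsto_intros)
  ultimately show "?slope h"
    using tendsto_lowerbound [OF _ _ trivial_limit_at_right_real] by fastforce
next
  \<comment> \<open>Sufficiency rests on convexity: the slope bounds the change of the l1 term from
    below, and the square only adds a nonnegative remainder.\<close>
  assume P: ?P and slope: "\<forall>h. ?adm h \<longrightarrow> ?slope h"
  show ?sol
    unfolding reg_bp_solution_iff
  proof (intro conjI ballI impI refl P)
    fix u assume u: "u \<in> poly_set C d" "A *v u = A *v x"
    define h where "h = u - x"
    have "?adm h"
      using u by (auto simp: h_def matrix_vector_mult_diff_distrib mem_poly_set inner_diff_right)
    then have "?slope h" using slope by blast
    moreover have "(norm u)\<^sup>2 = (norm x)\<^sup>2 + 2 * (x \<bullet> h) + (norm h)\<^sup>2"
      by (simp add: h_def power2_norm_eq_inner inner_diff_left inner_diff_right inner_commute)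
    then have "\<alpha> / 2 * (norm x)\<^sup>2 + \<alpha> * (x \<bullet> h) \<le> \<alpha> / 2 * (norm u)\<^sup>2"
      using \<alpha> by (simp add: algebra_simps)
    moreover have "l1_norm (E *v x) + l1_slope (E *v x) (E *v h) \<le> l1_norm (E *v u)"
      using l1_norm_add_ge [of "E *v x" "E *v h"]
      by (simp add: h_def flip: matrix_vector_right_distrib)
    ultimately show "reg_objective E l1_norm \<alpha> x \<le> reg_objective E l1_norm \<alpha> u"
      by (simp add: reg_objective_def)
  qed
qed

section \<open>Solution pieces with fixed signs and active constraints\<close>

lemma sgn_convex_combination:
  fixes p q :: real
  assumes "sgn p = sgn q" "0 \<le> a" "0 \<le> b" "a + b = 1"
  shows "sgn (a * p + b * q) = sgn p"
proof (cases "p = 0")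
  case True
  then show ?thesis using assms by (metis add.right_neutral mult_zero_right sgn_0_0)
next
  case False
  show ?thesis
  proof (cases "0 < p")
    case True
    then have "0 < q" using assms(1) by (metis sgn_1_pos)
    then show ?thesis using True assms convex_bound_lt [of "- p" 0 "- q" a b] by auto
  next
    case neg: False
    then have "p < 0" "q < 0" using False assms(1) by (auto simp: sgn_if split: if_splits)
    then show ?thesis using assms convex_bound_lt [of p 0 q a b] by auto
  qed
qed

lemma is_norm_l1_norm: "is_norm (l1_norm :: real^'p \<Rightarrow> real)"
  by (auto simp: is_norm_def l1_norm_def sum_nonneg sum_nonneg_eq_0_iff vec_eq_iff abs_mult
      sum_distrib_left simp flip: sum.distrib intro!: sum_mono abs_triangle_ineq)

text \<open>Gathers the solutions for all right-hand sides into finitely many convex pieces, so that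
  \<open>finite_union_convex_calm\<close> applies at any \<open>x0\<close>.\<close>

lemma reg_bp_l1_calm:
  fixes A :: "real^'n^'m" and E :: "real^'n^'p" and C :: "real^'n^'l"
  assumes \<alpha>: "0 < \<alpha>"
  obtains L where "0 \<le> L"
    "\<forall>\<^sub>F u in nhds x0. reg_bp_solution A E C d l1_norm \<alpha> (A *v u) u
        \<longrightarrow> norm (u - x0) \<le> L * norm (A *v u - A *v x0)"
proof -
  define S where "S = {x. reg_bp_solution A E C d l1_norm \<alpha> (A *v x) x}"
  \<comment> \<open>Where \<open>pat\<close> is constant, signs and active set are fixed, so
    optimality consists of inequalities affine in \<open>x\<close>.\<close>
  define pat where "pat x = ((\<lambda>i. sgn ((E *v x) $ i)), {i. C $ i \<bullet> x = d $ i})" for x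
  define \<R> where "\<R> = (\<lambda>p. {x \<in> S. pat x = p}) ` range pat"
  have "sgn r \<in> {-1, 0, 1}" for r :: real
    by (simp add: sgn_if)
  then have "range pat \<subseteq> {s. \<forall>i. s i \<in> {-1, 0, 1}} \<times> UNIV"
    by (simp add: pat_def image_subset_iff del: insert_iff)
  moreover have "finite ({s :: 'p \<Rightarrow> real. \<forall>i. s i \<in> {-1, 0, 1}} \<times> (UNIV :: 'l set set))"
    using finite_set_of_finite_funs [of "UNIV :: 'p set" "{-1, 0, 1 :: real}"] by simp
  ultimately have "finite (range pat)"
    by (rule finite_subset)
  then have "finite \<R>" by (simp add: \<R>_def)
  moreover have "convex R" if "R \<in> \<R>" for R
  proof (rule convexI)
    fix x y and a b :: real
    assume "x \<in> R" "y \<in> R" and ab: "0 \<le> a" "0 \<le> b" "a + b = 1"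
    with that have S: "x \<in> S" "y \<in> S" and pat: "pat x = pat y" and R: "R = {u \<in> S. pat u = pat x}"
      by (auto simp: \<R>_def)
    define u where "u = a *\<^sub>R x + b *\<^sub>R y"
    have sgn_xy: "sgn ((E *v x) $ i) = sgn ((E *v y) $ i)" for i
      using pat by (simp add: pat_def fun_eq_iff)
    have act_xy: "C $ i \<bullet> x = d $ i \<longleftrightarrow> C $ i \<bullet> y = d $ i" for i
      using pat by (auto simp: pat_def)
    have P: "x \<in> poly_set C d" "y \<in> poly_set C d"
      using S by (auto simp: S_def reg_bp_solution_iff)
    have "sgn ((E *v u) $ i) = sgn ((E *v x) $ i)" for i
      using sgn_convex_combination [OF sgn_xy ab]
      by (simp add: u_def matrix_vector_right_distrib matrix_vector_mult_scaleR)
    note sgn_u = this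
    have act_u: "C $ i \<bullet> u = d $ i \<longleftrightarrow> C $ i \<bullet> x = d $ i" for i
    proof (cases "C $ i \<bullet> x = d $ i")
      case True
      then show ?thesis using act_xy [of i] ab by (simp add: u_def inner_add_right flip: distrib_right)
    next
      case False
      then have "C $ i \<bullet> x < d $ i" "C $ i \<bullet> y < d $ i"
        using P act_xy [of i] by (auto simp: mem_poly_set less_le)
      from convex_bound_lt [OF this ab] False show ?thesis by (simp add: u_def inner_add_right)
    qed
    have slopes: "l1_slope (E *v u) k = l1_slope (E *v x) k"
        "l1_slope (E *v y) k = l1_slope (E *v x) k" for k
      using sgn_u sgn_xy by (auto intro: l1_slope_cong)
    have "u \<in> S"
      unfolding S_def mem_Collect_eq reg_bp_l1_optimal_iff [OF \<alpha>]
    proof (intro conjI allI impI)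
      show "u \<in> poly_set C d"
        unfolding u_def using P ab by (intro convexD convex_poly_set)
      fix h
      assume h: "A *v h = 0 \<and> (\<forall>i. C $ i \<bullet> u = d $ i \<longrightarrow> C $ i \<bullet> h \<le> 0)"
      have "0 \<le> \<alpha> * (x \<bullet> h) + l1_slope (E *v x) (E *v h)"
        using S(1) h act_u by (auto simp: S_def reg_bp_l1_optimal_iff [OF \<alpha>])
      moreover have "0 \<le> \<alpha> * (y \<bullet> h) + l1_slope (E *v x) (E *v h)"
        using S(2) h act_u act_xy slopes(2) by (auto simp: S_def reg_bp_l1_optimal_iff [OF \<alpha>])
      \<comment> \<open>As the slope terms coincide and \<open>a + b = 1\<close>, the weighted sum
        of the two conditions is the condition for \<open>u\<close>.\<close>
      ultimately have "0 \<le> a * (\<alpha> * (x \<bullet> h) + l1_slope (E *v x) (E *v h))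
          + b * (\<alpha> * (y \<bullet> h) + l1_slope (E *v x) (E *v h))"
        using ab by simp
      also have "\<dots> = \<alpha> * (u \<bullet> h) + (a + b) * l1_slope (E *v x) (E *v h)"
        by (simp add: u_def inner_add_left algebra_simps)
      finally show "0 \<le> \<alpha> * (u \<bullet> h) + l1_slope (E *v u) (E *v h)"
        using ab(3) slopes(1) by simp
    qed
    moreover have "pat u = pat x" by (simp add: pat_def sgn_u act_u)
    ultimately show "a *\<^sub>R x + b *\<^sub>R y \<in> R" by (simp add: R u_def)
  qed
  \<comment> \<open>Equal images mean equal right-hand sides, so injectivity is uniqueness of the
    solution.\<close>
  moreover have "inj_on (\<lambda>x. A *v x) R" if "R \<in> \<R>" for R
  proof (rule inj_onI)
    fix x y assume "x \<in> R" "y \<in> R" "A *v x = A *v y"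
    then show "x = y"
      using that reg_bp_solution_unique [OF is_norm_l1_norm \<alpha>, of A E C d "A *v x" x y]
      by (auto simp: \<R>_def S_def)
  qed
  moreover have "linear (\<lambda>x. A *v x)" by simp
  ultimately obtain L where L: "0 \<le> L"
    "\<forall>\<^sub>F u in nhds x0. u \<in> \<Union>\<R> \<longrightarrow> norm (u - x0) \<le> L * norm (A *v u - A *v x0)"
    using finite_union_convex_calm [of "\<lambda>x. A *v x" \<R> x0] by blast
  have "\<Union>\<R> = S" by (auto simp: \<R>_def)
  with L show ?thesis using that by (simp add: S_def)
qed

section \<open>Convergence of the two-stage algorithm\<close>

text \<open>Multiplying by \<open>norm a\<close> splits the difference into \<open>y - a\<close> and
  a unit vector scaled by \<open>norm a - norm y\<close>, each of size at most
  \<open>norm (y - a)\<close>.\<close>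

lemma norm_normalize_diff_le:
  fixes y a :: "'a::real_normed_vector"
  assumes "a \<noteq> 0"
  shows "norm ((1 / norm y) *\<^sub>R y - (1 / norm a) *\<^sub>R a) \<le> 2 / norm a * norm (y - a)"
proof (cases "y = 0")
  \<comment> \<open>Division by zero normalises 0 to 0, and the inequality reads 1 \<le> 2.\<close>
  case True
  then show ?thesis using assms by simp
next
  case False
  have "norm a *\<^sub>R ((1 / norm y) *\<^sub>R y - (1 / norm a) *\<^sub>R a)
      = (y - a) + (norm a - norm y) *\<^sub>R ((1 / norm y) *\<^sub>R y)"
    using assms False by (simp add: algebra_simps)
  then have "norm a * norm ((1 / norm y) *\<^sub>R y - (1 / norm a) *\<^sub>R a)
      = norm ((y - a) + (norm a - norm y) *\<^sub>R ((1 / norm y) *\<^sub>R y))"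
    by (metis abs_norm_cancel norm_scaleR)
  also have "\<dots> \<le> norm (y - a) + norm ((norm a - norm y) *\<^sub>R ((1 / norm y) *\<^sub>R y))"
    by (rule norm_triangle_ineq)
  also have "\<dots> = norm (y - a) + \<bar>norm a - norm y\<bar>"
    using False by simp
  also have "\<dots> \<le> 2 * norm (y - a)"
    using norm_triangle_ineq3 [of a y] by (simp add: norm_minus_commute)
  finally show ?thesis using assms by (simp add: field_simps)
qed

text \<open>The two problems are told apart only here: the convergence proof uses just this bound at
  \<open>ystar\<close>.\<close>

lemma dual_rhs_lipschitz:
  fixes A :: "real^'n^'m" and E :: "real^'n^'p" and C :: "real^'n^'l"
  assumes nrm: "is_norm nrm"
    and problem:
      "(lasso_dual_solution A b E C d nrm ystar \<and> rhs = lasso_rhs b) \<or>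
       (bpdn_standing A b E C d nrm \<sigma> \<and> bpdn_dual_solution A b E C d nrm \<sigma> ystar \<and>
        rhs = bpdn_rhs b \<sigma>)"
  obtains M where "0 \<le> M" "\<And>y. norm (rhs y - rhs ystar) \<le> M * norm (y - ystar)"
  using problem
proof (elim disjE conjE)
  assume "rhs = lasso_rhs b"
  then show ?thesis by (intro that [of 1]) (auto simp: lasso_rhs_def)
next
  assume st: "bpdn_standing A b E C d nrm \<sigma>" "bpdn_dual_solution A b E C d nrm \<sigma> ystar"
    and rhs: "rhs = bpdn_rhs b \<sigma>"
  have "0 < \<sigma>" using st(1) by (simp add: bpdn_standing_def)
  have "ystar \<noteq> 0" using bpdn_dual_solution_nonzero [OF nrm st] .
  have "norm (rhs y - rhs ystar) \<le> \<sigma> * (2 / norm ystar) * norm (y - ystar)" for y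
  proof -
    have "rhs y - rhs ystar = \<sigma> *\<^sub>R ((1 / norm y) *\<^sub>R y - (1 / norm ystar) *\<^sub>R ystar)"
      by (simp add: rhs bpdn_rhs_def scaleR_diff_right)
    then have "norm (rhs y - rhs ystar)
        = \<sigma> * norm ((1 / norm y) *\<^sub>R y - (1 / norm ystar) *\<^sub>R ystar)"
      using \<open>0 < \<sigma>\<close> by (simp only: norm_scaleR abs_of_pos)
    also have "\<dots> \<le> \<sigma> * (2 / norm ystar * norm (y - ystar))"
      using norm_normalize_diff_le [OF \<open>ystar \<noteq> 0\<close>] \<open>0 < \<sigma>\<close> by (intro mult_left_mono) auto
    finally show ?thesis by (simp add: mult.assoc)
  qed
  then show ?thesis
    using \<open>0 < \<sigma>\<close> by (intro that [of "\<sigma> * (2 / norm ystar)"]) auto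
qed

text \<open>For large \<open>k\<close> the iterates tend to \<open>z k\<close>, which itself moves
  with \<open>k\<close>. Limit and rate therefore appear twice: iterated, with second-stage
  constants that may depend on \<open>k\<close>, and joint, under a second-stage hypothesis on the
  product filter.\<close>

theorem theorem6p4:
  fixes A :: "real^'n^'m" and b :: "real^'m" and E :: "real^'n^'p"
    and C :: "real^'n^'l" and d :: "real^'l" and nrm :: "real^'p \<Rightarrow> real"
    and \<alpha> \<sigma> :: real and rhs :: "real^'m \<Rightarrow> real^'m"
    and ystar :: "real^'m" and y :: "nat \<Rightarrow> real^'m"
    and x :: "nat \<Rightarrow> nat \<Rightarrow> real^'n"
    and z :: "nat \<Rightarrow> real^'n" and xstar :: "real^'n"
  assumes nrm: "is_norm nrm"
    and nonempty: "poly_set C d \<noteq> {}"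
    and alpha: "0 < \<alpha>"
    and problem:
      "(lasso_dual_solution A b E C d nrm ystar \<and> rhs = lasso_rhs b) \<or>
       (bpdn_standing A b E C d nrm \<sigma> \<and> bpdn_dual_solution A b E C d nrm \<sigma> ystar \<and>
        rhs = bpdn_rhs b \<sigma>)"
    and first_stage: "y \<longlonglongrightarrow> ystar"
    and feasible: "\<forall>\<^sub>F k in sequentially. rhs (y k) \<in> (\<lambda>u. A *v u) ` poly_set C d"
    and z_def: "\<And>k. z k = the_reg_bp_solution A E C d nrm \<alpha> (rhs (y k))"
    and xstar_def: "xstar = the_reg_bp_solution A E C d nrm \<alpha> (rhs ystar)"
    and second_stage: "\<forall>\<^sub>F k in sequentially. x k \<longlonglongrightarrow> z k"
  shows
    "(\<exists>!u. reg_bp_solution A E C d nrm \<alpha> (rhs ystar) u) \<and>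
     (\<forall>\<^sub>F k in sequentially. \<exists>!u. reg_bp_solution A E C d nrm \<alpha> (rhs (y k)) u) \<and>

     (\<forall>\<epsilon>>0. \<forall>\<^sub>F k in sequentially. \<forall>\<^sub>F s in sequentially. dist (x k s) xstar < \<epsilon>) \<and>
     (((\<lambda>(k, s). x k s - z k) \<longlongrightarrow> 0) (sequentially \<times>\<^sub>F sequentially) \<longrightarrow>
      ((\<lambda>(k, s). x k s) \<longlongrightarrow> xstar) (sequentially \<times>\<^sub>F sequentially)) \<and>

     (\<forall>q r :: real. nrm = l1_norm \<and> 0 < q \<and> 0 < r \<and>
        (\<lambda>k. norm (y k - ystar)) \<in> O(\<lambda>k. 1 / real k powr q) \<longrightarrow>
        ((\<forall>\<^sub>F k in sequentially. (\<lambda>s. norm (x k s - z k)) \<in> O(\<lambda>s. 1 / real s powr r)) \<longrightarrow>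
         (\<exists>f \<in> O(\<lambda>k. 1 / real k powr q). \<forall>\<^sub>F k in sequentially.
            \<exists>g \<in> O(\<lambda>s. 1 / real s powr r). \<forall>\<^sub>F s in sequentially.
              norm (x k s - xstar) \<le> f k + g s)) \<and>
        ((\<lambda>(k, s). norm (x k s - z k))
           \<in> O[sequentially \<times>\<^sub>F sequentially](\<lambda>(k, s). 1 / real s powr r) \<longrightarrow>
         (\<lambda>(k, s). norm (x k s - xstar))
           \<in> O[sequentially \<times>\<^sub>F sequentially](\<lambda>(k, s). 1 / real k powr q + 1 / real s powr r)))"
proof -
  let ?sol = "reg_bp_solution A E C d nrm \<alpha>" and ?AP = "(\<lambda>u. A *v u) ` poly_set C d"
  let ?SS = "sequentially \<times>\<^sub>F sequentially :: (nat \<times> nat) filter"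
  obtain M where M: "0 \<le> M" "\<And>v. norm (rhs v - rhs ystar) \<le> M * norm (v - ystar)"
    using dual_rhs_lipschitz [OF nrm problem] by blast
  have rhs_lim: "(\<lambda>k. rhs (y k)) \<longlonglongrightarrow> rhs ystar"
  proof (rule LIM_zero_cancel, rule Lim_null_comparison)
    show "\<forall>\<^sub>F k in sequentially. norm (rhs (y k) - rhs ystar) \<le> M * norm (y k - ystar)"
      using M(2) by simp
    show "(\<lambda>k. M * norm (y k - ystar)) \<longlonglongrightarrow> 0"
      using first_stage by (intro tendsto_mult_right_zero tendsto_norm_zero) (simp add: LIM_zero)
  qed
  have "closed ?AP" by (rule closed_linear_image_poly_set) simp
  \<comment> \<open>Only the perturbed right-hand sides are assumed admissible; closedness passes
    this on to their limit.\<close>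
  then have star_AP: "rhs ystar \<in> ?AP"
    by (rule Lim_in_closed_set [OF _ feasible _ rhs_lim]) simp
  have sol_star: "?sol (rhs ystar) xstar"
    unfolding xstar_def by (rule the_reg_bp_solution [OF nrm alpha star_AP])
  have sol_z: "\<forall>\<^sub>F k in sequentially. ?sol (rhs (y k)) (z k)"
    using feasible by eventually_elim (simp add: z_def the_reg_bp_solution [OF nrm alpha])
  have z_lim: "z \<longlonglongrightarrow> xstar"
    by (rule reg_bp_solution_tendsto [OF nrm alpha sol_star sol_z rhs_lim])
  have ex1: "\<exists>!u. ?sol (rhs ystar) u"
    by (rule ex1_reg_bp_solution [OF nrm alpha star_AP])
  have ex1_k: "\<forall>\<^sub>F k in sequentially. \<exists>!u. ?sol (rhs (y k)) u"
    using feasible by eventually_elim (rule ex1_reg_bp_solution [OF nrm alpha])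
  have iterated: "\<forall>\<^sub>F k in sequentially. \<forall>\<^sub>F s in sequentially. dist (x k s) xstar < \<epsilon>"
    if "0 < \<epsilon>" for \<epsilon>
    using second_stage tendstoD [OF z_lim that]
  proof eventually_elim
    case (elim k)
    have "((\<lambda>s. dist (x k s) xstar) \<longlongrightarrow> dist (z k) xstar) sequentially"
      using elim(1) by (intro tendsto_intros)
    then show ?case using elim(2) by (rule order_tendstoD)
  qed
  have joint: "((\<lambda>(k, s). x k s) \<longlongrightarrow> xstar) ?SS"
    if "((\<lambda>(k, s). x k s - z k) \<longlongrightarrow> 0) ?SS"
  proof -
    have "((\<lambda>p. z (fst p)) \<longlongrightarrow> xstar) ?SS"
      using z_lim filterlim_fst by (rule filterlim_compose)
    from tendsto_add [OF that this] show ?thesis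
      by (simp add: case_prod_unfold)
  qed
  have z_rate: "(\<lambda>k. norm (z k - xstar)) \<in> O(\<lambda>k. 1 / real k powr q)"
    if l1: "nrm = l1_norm" and y_rate: "(\<lambda>k. norm (y k - ystar)) \<in> O(\<lambda>k. 1 / real k powr q)"
    for q
  proof -
    \<comment> \<open>Since \<open>z k\<close> solves the problem for its own image
      \<open>A *v z k\<close> and tends to \<open>xstar\<close>, calmness applies to all late
      \<open>k\<close>.\<close>
    obtain L where L: "0 \<le> L" "\<forall>\<^sub>F u in nhds xstar. reg_bp_solution A E C d l1_norm \<alpha> (A *v u) u
        \<longrightarrow> norm (u - xstar) \<le> L * norm (A *v u - A *v xstar)"
      using reg_bp_l1_calm [OF alpha] by blast
    have "\<forall>\<^sub>F k in sequentially. norm (norm (z k - xstar)) \<le> L * M * norm (norm (y k - ystar))"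
      using eventually_compose_filterlim [OF L(2) z_lim] sol_z
    proof eventually_elim
      case (elim k)
      then have "A *v z k = rhs (y k)" by (simp add: reg_bp_solution_iff)
      moreover have "A *v xstar = rhs ystar" using sol_star by (simp add: reg_bp_solution_iff)
      ultimately have "norm (z k - xstar) \<le> L * norm (rhs (y k) - rhs ystar)"
        using elim l1 by simp
      also have "\<dots> \<le> L * (M * norm (y k - ystar))"
        using M(2) L(1) by (intro mult_left_mono)
      finally show ?case by simp
    qed
    then have "(\<lambda>k. norm (z k - xstar)) \<in> O(\<lambda>k. norm (y k - ystar))"
      by (rule bigoI)
    then show ?thesis using y_rate by (rule landau_o.big_trans)
  qed
  have triangle: "norm (x k s - xstar) \<le> norm (z k - xstar) + norm (x k s - z k)" for k s
    using norm_triangle_ineq [of "z k - xstar" "x k s - z k"] by simp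
  have rate: "\<exists>f \<in> O(\<lambda>k. 1 / real k powr q). \<forall>\<^sub>F k in sequentially.
      \<exists>g \<in> O(\<lambda>s. 1 / real s powr r). \<forall>\<^sub>F s in sequentially. norm (x k s - xstar) \<le> f k + g s"
    if rates: "nrm = l1_norm" "(\<lambda>k. norm (y k - ystar)) \<in> O(\<lambda>k. 1 / real k powr q)"
      and x_rate: "\<forall>\<^sub>F k in sequentially. (\<lambda>s. norm (x k s - z k)) \<in> O(\<lambda>s. 1 / real s powr r)"
    for q r :: real
  \<comment> \<open>The witness for \<open>f\<close> is the distance from \<open>z k\<close> to
    \<open>xstar\<close>, the one for \<open>g\<close> the distance from \<open>x k s\<close> to
    \<open>z k\<close>.\<close>
  proof (rule bexI [OF _ z_rate [OF rates]])
    show "\<forall>\<^sub>F k in sequentially. \<exists>g \<in> O(\<lambda>s. 1 / real s powr r). \<forall>\<^sub>F s in sequentially.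
        norm (x k s - xstar) \<le> norm (z k - xstar) + g s"
      using x_rate by eventually_elim (rule bexI, use triangle in auto)
  qed
  have joint_rate: "(\<lambda>(k, s). norm (x k s - xstar)) \<in> O[?SS](\<lambda>(k, s). 1 / real k powr q + 1 / real s powr r)"
    if rates: "nrm = l1_norm" "(\<lambda>k. norm (y k - ystar)) \<in> O(\<lambda>k. 1 / real k powr q)"
      and x_rate: "(\<lambda>(k, s). norm (x k s - z k)) \<in> O[?SS](\<lambda>(k, s). 1 / real s powr r)"
    for q r :: real
  proof -
    obtain c1 where c1: "0 < c1"
      "\<forall>\<^sub>F k in sequentially. norm (norm (z k - xstar)) \<le> c1 * norm (1 / real k powr q)"
      using z_rate [OF rates] by (rule landau_o.bigE)
    \<comment> \<open>The bound in \<open>k\<close> alone is pulled back along \<open>fst\<close> to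
      the product filter.\<close>
    have z_ev: "\<forall>\<^sub>F p in ?SS. norm (z (fst p) - xstar) \<le> c1 * (1 / real (fst p) powr q)"
      using eventually_compose_filterlim [OF c1(2) filterlim_fst] by simp
    obtain c2 where c2: "0 < c2"
      "\<forall>\<^sub>F p in ?SS. norm (case p of (k, s) \<Rightarrow> norm (x k s - z k))
          \<le> c2 * norm (case p of (k, s) \<Rightarrow> 1 / real s powr r)"
      using x_rate by (rule landau_o.bigE)
    show ?thesis
    proof (rule bigoI)
      show "\<forall>\<^sub>F p in ?SS. norm (case p of (k, s) \<Rightarrow> norm (x k s - xstar))
          \<le> (c1 + c2) * norm (case p of (k, s) \<Rightarrow> 1 / real k powr q + 1 / real s powr r)"
        using z_ev c2(2)
      proof eventually_elim
        case (elim p)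
        obtain k s where p: "p = (k, s)" by (cases p)
        define a b where "a = 1 / real k powr q" and "b = 1 / real s powr r"
        have ab: "0 \<le> a" "0 \<le> b" by (simp_all add: a_def b_def)
        have "norm (x k s - xstar) \<le> c1 * a + c2 * b"
          using triangle [of k s] elim by (simp add: p a_def b_def)
        also have "\<dots> \<le> (c1 + c2) * (a + b)"
          using ab c1(1) c2(1) by (simp add: algebra_simps)
        finally show ?case using ab by (simp add: p a_def b_def)
      qed
    qed
  qed
  show ?thesis
    using ex1 ex1_k iterated joint rate joint_rate by blast
qed

end
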